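(* Let $M=(E,\mathcal{I})$ be a matroid with $E=\{1,\dots,n\}$ and rank $r_M$, and for $0\le k\le r_M$ let \[f_k(M)=\sum_{I\in\mathcal{I},\,|I|=k}\ \prod_{i\in I}x_i\in\mathbb{R}[x_1,\dots,x_n].\] Then for any integers $p\ge2$ and $l$ with $p-1<l<r_M$, \[f_l(M)^p\ \ge\ \prod_{j=1}^{p-1}\left(1+\frac{j}{(p-1)l}\right)\, f_{l+1}(M)^{p-1}\,f_{l-p+1}(M),\] where $F\ge G$ means that $F-G$ has nonnegative coefficients.
   Context: The rank $r_M$ is the maximum size of an independent set of $M$. *)

theory Defs
  imports Complex_Main "HOL-Library.Poly_Mapping"
begin

locale matroid =
  fixes E :: "'a set" and \<I> :: "'a set set"
  assumes finite_ground: "finite E"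
    and indep_subset_ground: "I \<in> \<I> \<Longrightarrow> I \<subseteq> E"
    and empty_indep: "{} \<in> \<I>"
    and hereditary: "\<lbrakk>I \<in> \<I>; J \<subseteq> I\<rbrakk> \<Longrightarrow> J \<in> \<I>"
    and augmentation: "\<lbrakk>I \<in> \<I>; J \<in> \<I>; card I < card J\<rbrakk> \<Longrightarrow> \<exists>e \<in> J - I. insert e I \<in> \<I>"

definition matroid_rank :: "'a set set \<Rightarrow> nat" where
  "matroid_rank \<I> = Max (card ` \<I>)"

(* Polynomials over the reals: the inner finitely supported map is the exponent vector of a
   monomial, the outer one assigns coefficients. Multiplication on this type is convolution.
   The polynomials in x_1, ..., x_n are those whose monomials only involve the variables 1, ..., n. *)
type_synonym 'a rpoly = "('a \<Rightarrow>\<^sub>0 nat) \<Rightarrow>\<^sub>0 real"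

definition Var :: "'a \<Rightarrow> 'a rpoly" where
  "Var i = Poly_Mapping.single (Poly_Mapping.single i 1) 1"

definition Const :: "real \<Rightarrow> 'a rpoly" where
  "Const c = Poly_Mapping.single 0 c"

definition indep_poly :: "'a set set \<Rightarrow> nat \<Rightarrow> 'a rpoly" where
  "indep_poly \<I> k = (\<Sum>I | I \<in> \<I> \<and> card I = k. \<Prod>i\<in>I. Var i)"

(* Not the library order on finitely supported maps, which is lexicographic. *)
definition coeff_ge :: "'a rpoly \<Rightarrow> 'a rpoly \<Rightarrow> bool" (infix \<open>\<succeq>\<close> 50) where
  "F \<succeq> G \<longleftrightarrow> (\<forall>m. 0 \<le> Poly_Mapping.lookup (F - G) m)"

end

(*
The coefficientwise inequality follows from the two-factor case
  f_a f_b >= ((a + 1) / b) f_{a+1} f_{b-1}   for a >= b >= 1,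
applied with a = l and b = l, l - 1, ..., l - p + 2, since (l + 1) / (l + 1 - j) >= 1 + j / ((p - 1) l).

A monomial with exponents 2 on S and 1 on T reduces the two-factor case, after contracting S, to the
numbers N_k of k-subsets A of T such that A and T - A are both independent; with n = |T| one needs
(k + 1) N_{k+1} <= (n - k) N_k for 2k >= n. As c_k = k! (n - k)! N_k is symmetric in k and positive
between any two symmetric positions where it is positive, it suffices that c is log-concave.

Put f(x, y) = sum over independent I of x^I y^(n - |I|). Then c_k is the derivative of
F = f(x, y) f(x', z) in the directions e_i + e_i' (i in T), n - k times in y and k times in z, so
log-concavity is an Alexandrov-Fenchel inequality for F, i.e. F is Lorentzian. This is shown by
induction on the degree: the quadratic derivatives of F are hyperbolic (here the parallel classes of a
contraction enter), and a Bochner-type argument lifts hyperbolicity through one more degree.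
*)
theory Submission
  imports Defs "HOL-Analysis.Convex" "HOL-Analysis.Function_Topology" "HOL-Library.Multiset"
begin

text \<open>The homogenising exponent involves the size of the ground set and not the rank, and this
  fixes the constant. After derivatives along an independent set S and q times along y, a quadratic
  polynomial is left when q + 2 = |E - S|. Its y^2 term carries (q + 2)!, and q + 2 bounds the
  number of parallel classes of the contraction, which is what Cauchy-Schwarz requires.
  Differentiating y and z away leaves the factorials in c_k, and these turn plain log-concavity into
  the ratio (n - k) / (k + 1).

  Two disjoint copies of the variables are used because a derivative along e_i + e_i' puts i into
  exactly one of two sets, so that complementary pairs are counted.

  Two obstacles shape the induction. Second derivatives may have zero rows, and the directions of
  interest are coordinate vectors; the Perron-type argument therefore runs on the support for
  strictly positive directions, and a limit recovers nonnegative ones. Hyperbolicity is stated as an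
  inequality, which admits the zero form and avoids spectral theory.\<close>

section \<open>Hyperbolic mixed derivatives\<close>

text \<open>Reversed Cauchy--Schwarz inequality: for symmetric forms, at most one positive direction.\<close>

definition hyperbolic :: "(('b \<Rightarrow> real) \<Rightarrow> ('b \<Rightarrow> real) \<Rightarrow> real) \<Rightarrow> bool" where
  "hyperbolic B \<longleftrightarrow> (\<forall>u w. 0 \<le> B w w \<longrightarrow> B u u * B w w \<le> (B u w)\<^sup>2)"

text \<open>Any \<open>w\<close> with positive square has \<open>B w h\<close> nonzero, so adding a
  suitable multiple of \<open>w\<close> to \<open>u\<close> gives a vector orthogonal to
  \<open>h\<close>. The form is nonpositive there; multiplying by \<open>B w w\<close> and
  completing the square in that multiple gives the inequality.\<close>

lemma hyperbolicI:
  fixes B :: "('b \<Rightarrow> real) \<Rightarrow> ('b \<Rightarrow> real) \<Rightarrow> real"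
  assumes sym: "\<And>u w. B u w = B w u"
    and lin: "\<And>u w z t. B (\<lambda>i. u i + t * w i) z = B u z + t * B w z"
    and pos: "0 < B h h"
    and nonpos: "\<And>u. B u h = 0 \<Longrightarrow> B u u \<le> 0"
  shows "hyperbolic B"
  unfolding hyperbolic_def
proof (intro allI impI)
  fix u w assume w: "0 \<le> B w w"
  show "B u u * B w w \<le> (B u w)\<^sup>2"
  proof (cases "B w w = 0")
    case False
    with w have wpos: "0 < B w w" by simp
    have wh: "B w h \<noteq> 0" using nonpos[of w] wpos by auto
    define t where "t = - (B u h / B w h)"
    define z where "z = (\<lambda>i. u i + t * w i)"
    have zl: "B z x = B u x + t * B w x" for x unfolding z_def by (rule lin)
    have "B z h = 0" using wh by (simp add: zl t_def)
    from nonpos[OF this] have "B z z \<le> 0" .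
    moreover have "B z z = B u u + 2 * t * B u w + t\<^sup>2 * B w w"
      unfolding zl[of z] sym[of u z] sym[of w z] zl sym[of w u]
      by (simp add: algebra_simps power2_eq_square)
    ultimately have "B u u + 2 * t * B u w + t\<^sup>2 * B w w \<le> 0" by simp
    then have "B w w * (B u u + 2 * t * B u w + t\<^sup>2 * B w w) \<le> 0"
      using wpos by (simp add: mult_le_0_iff)
    moreover have "B w w * (B u u + 2 * t * B u w + t\<^sup>2 * B w w)
        = B u u * B w w - (B u w)\<^sup>2 + (B u w + t * B w w)\<^sup>2"
      by (simp add: algebra_simps power2_eq_square)
    ultimately show ?thesis using zero_le_power2[of "B u w + t * B w w"] by linarith
  qed simp
qed

text \<open>If \<open>\<Phi> \<alpha>\<close> is the derivative \<open>\<partial>\<^sup>\<alpha> F\<close> of a homogeneous polynomial \<open>F\<close> of degree \<open>d\<close>,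
  then \<open>mix X \<Phi> [v\<^sub>1, \<dots>, v\<^sub>d]\<close> is the iterated directional derivative of \<open>F\<close> along the \<open>v\<^sub>i\<close>.\<close>

primrec mix :: "'b set \<Rightarrow> ('b multiset \<Rightarrow> real) \<Rightarrow> ('b \<Rightarrow> real) list \<Rightarrow> real" where
  "mix X \<Phi> [] = \<Phi> {#}"
| "mix X \<Phi> (v # vs) = (\<Sum>i\<in>X. v i * mix X (\<lambda>\<alpha>. \<Phi> (add_mset i \<alpha>)) vs)"

lemma mix_swap: "mix X \<Phi> (u # w # vs) = mix X \<Phi> (w # u # vs)"
proof -
  have "mix X \<Phi> (u # w # vs)
      = (\<Sum>i\<in>X. \<Sum>j\<in>X. u i * (w j * mix X (\<lambda>\<alpha>. \<Phi> (add_mset i (add_mset j \<alpha>))) vs))"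
    by (simp add: sum_distrib_left)
  also have "\<dots> = (\<Sum>j\<in>X. \<Sum>i\<in>X. u i * (w j * mix X (\<lambda>\<alpha>. \<Phi> (add_mset i (add_mset j \<alpha>))) vs))"
    by (rule sum.swap)
  also have "\<dots> = mix X \<Phi> (w # u # vs)"
    by (simp add: sum_distrib_left mult.left_commute add_mset_commute)
  finally show ?thesis .
qed

lemma mix_rotate: "mix X \<Phi> (v # u # w # vs) = mix X \<Phi> (u # w # v # vs)"
proof -
  have "mix X \<Phi> (v # u # w # vs) = mix X \<Phi> (u # v # w # vs)" by (rule mix_swap)
  also have "\<dots> = mix X \<Phi> (u # w # v # vs)"
    unfolding mix.simps(2)[of X \<Phi> u] by (subst mix_swap) simp
  finally show ?thesis .
qed

lemma mix_linear: "mix X \<Phi> ((\<lambda>i. u i + t * w i) # vs) = mix X \<Phi> (u # vs) + t * mix X \<Phi> (w # vs)"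
  by (simp add: sum_distrib_left sum.distrib algebra_simps)

section \<open>Signs and supports of mixed derivatives\<close>

lemma mix_nonneg:
  assumes "\<And>\<alpha>. set_mset \<alpha> \<subseteq> X \<Longrightarrow> 0 \<le> \<Phi> \<alpha>"
    and "\<And>v i. v \<in> set vs \<Longrightarrow> i \<in> X \<Longrightarrow> 0 \<le> v i"
  shows "0 \<le> mix X \<Phi> vs"
  using assms by (induction vs arbitrary: \<Phi>) (auto intro!: sum_nonneg mult_nonneg_nonneg)

lemma mix_eq_0:
  assumes "\<And>\<alpha>. set_mset \<alpha> \<subseteq> X \<Longrightarrow> size \<alpha> = length vs \<Longrightarrow> \<Phi> \<alpha> = 0"
  shows "mix X \<Phi> vs = 0"
  using assms by (induction vs arbitrary: \<Phi>) (auto intro!: sum.neutral)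

text \<open>For a polynomial of degree \<open>size \<alpha> + k\<close> with nonnegative
  coefficients this says that the derivative of order \<alpha> is not the zero polynomial.\<close>

definition extendible :: "'b set \<Rightarrow> ('b multiset \<Rightarrow> real) \<Rightarrow> nat \<Rightarrow> 'b multiset \<Rightarrow> bool" where
  "extendible X \<Phi> k \<alpha> \<longleftrightarrow> (\<exists>\<beta>. set_mset \<beta> \<subseteq> X \<and> size \<beta> = k \<and> 0 < \<Phi> (\<alpha> + \<beta>))"

lemma extendible_link:
  "extendible X (\<lambda>\<alpha>. \<Phi> (add_mset i \<alpha>)) k \<alpha> = extendible X \<Phi> k (add_mset i \<alpha>)"
  by (simp add: extendible_def)

lemma extendible_Suc: "extendible X \<Phi> (Suc k) \<alpha> \<longleftrightarrow> (\<exists>i\<in>X. extendible X \<Phi> k (add_mset i \<alpha>))"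
proof
  assume "extendible X \<Phi> (Suc k) \<alpha>"
  then obtain \<beta> where \<beta>: "set_mset \<beta> \<subseteq> X" "size \<beta> = Suc k" "0 < \<Phi> (\<alpha> + \<beta>)"
    by (auto simp: extendible_def)
  from size_eq_Suc_imp_eq_union[OF \<beta>(2)] obtain i \<gamma> where "\<beta> = add_mset i \<gamma>" by blast
  with \<beta> show "\<exists>i\<in>X. extendible X \<Phi> k (add_mset i \<alpha>)"
    by (auto simp: extendible_def)
next
  assume "\<exists>i\<in>X. extendible X \<Phi> k (add_mset i \<alpha>)"
  then obtain i \<beta> where "i \<in> X" "set_mset \<beta> \<subseteq> X" "size \<beta> = k" "0 < \<Phi> (add_mset i \<alpha> + \<beta>)"
    by (auto simp: extendible_def)
  then show "extendible X \<Phi> (Suc k) \<alpha>"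
    unfolding extendible_def by (intro exI[of _ "add_mset i \<beta>"]) auto
qed

text \<open>The expansion of \<open>mix\<close> has nonnegative terms with strictly positive
  weights, so positivity depends on the support alone and not on the directions. Irreducibility of
  the second derivatives thus becomes a combinatorial condition.\<close>

lemma mix_pos_iff:
  assumes fin: "finite X"
    and "\<And>\<alpha>. set_mset \<alpha> \<subseteq> X \<Longrightarrow> 0 \<le> \<Phi> \<alpha>"
    and "\<And>v i. v \<in> set vs \<Longrightarrow> i \<in> X \<Longrightarrow> 0 < v i"
  shows "0 < mix X \<Phi> vs \<longleftrightarrow> extendible X \<Phi> (length vs) {#}"
  using assms(2,3)
proof (induction vs arbitrary: \<Phi>)
  case Nil
  then show ?case by (simp add: extendible_def)
next
  case (Cons v vs)
  have nn: "0 \<le> mix X (\<lambda>\<alpha>. \<Phi> (add_mset i \<alpha>)) vs" if "i \<in> X" for i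
    using Cons.prems that by (intro mix_nonneg) (auto simp: less_imp_le)
  have IH: "0 < mix X (\<lambda>\<alpha>. \<Phi> (add_mset i \<alpha>)) vs \<longleftrightarrow> extendible X \<Phi> (length vs) {#i#}" if "i \<in> X" for i
    using Cons.IH[of "\<lambda>\<alpha>. \<Phi> (add_mset i \<alpha>)"] Cons.prems that by (simp add: extendible_link)
  have vpos: "0 < v i" if "i \<in> X" for i using Cons.prems(2) that by simp
  have "0 < mix X \<Phi> (v # vs) \<longleftrightarrow> (\<exists>i\<in>X. 0 < v i * mix X (\<lambda>\<alpha>. \<Phi> (add_mset i \<alpha>)) vs)"
  proof
    assume pos: "0 < mix X \<Phi> (v # vs)"
    show "\<exists>i\<in>X. 0 < v i * mix X (\<lambda>\<alpha>. \<Phi> (add_mset i \<alpha>)) vs"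
    proof (rule ccontr)
      assume "\<not> ?thesis"
      then have "mix X \<Phi> (v # vs) \<le> 0" by (auto intro!: sum_nonpos simp: not_less)
      with pos show False by simp
    qed
  next
    assume "\<exists>i\<in>X. 0 < v i * mix X (\<lambda>\<alpha>. \<Phi> (add_mset i \<alpha>)) vs"
    then obtain i where i: "i \<in> X" "0 < v i * mix X (\<lambda>\<alpha>. \<Phi> (add_mset i \<alpha>)) vs" by blast
    show "0 < mix X \<Phi> (v # vs)"
      unfolding mix.simps
      using fin i vpos nn by (intro sum_pos2[where i = i]) (auto simp: less_imp_le)
  qed
  also have "\<dots> \<longleftrightarrow> (\<exists>i\<in>X. extendible X \<Phi> (length vs) {#i#})"
    using IH vpos by (auto simp: zero_less_mult_iff less_imp_le not_less dest: order.asym)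
  finally show ?case by (simp add: extendible_Suc)
qed

text \<open>\<open>W\<close> defines a connected reversible Markov chain; \<open>bochner\<close> says \<open>\<langle>g, P g\<rangle> \<le> \<langle>P g, P g\<rangle>\<close>,
  so every eigenvalue of \<open>P\<close> is \<open>\<le> 0\<close> or \<open>\<ge> 1\<close>. By connectivity only constants attain \<open>1\<close>. The largest
  Rayleigh quotient orthogonal to the constants exists by compactness.\<close>

lemma reversible_form_nonpos:
  fixes W :: "'b \<Rightarrow> 'b \<Rightarrow> real" and g :: "'b \<Rightarrow> real"
  assumes fin: "finite Y"
    and sym: "\<And>i j. W i j = W j i"
    and nonneg: "\<And>i j. i \<in> Y \<Longrightarrow> j \<in> Y \<Longrightarrow> 0 \<le> W i j"
    and pos: "\<And>i. i \<in> Y \<Longrightarrow> 0 < (\<Sum>j\<in>Y. W i j)"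
    and conn: "\<And>i j. i \<in> Y \<Longrightarrow> j \<in> Y \<Longrightarrow> \<exists>c\<in>Y. 0 < W i c \<and> 0 < W c j"
    and bochner: "\<And>g. (\<Sum>i\<in>Y. \<Sum>j\<in>Y. W i j * g i * g j)
      \<le> (\<Sum>i\<in>Y. (\<Sum>j\<in>Y. W i j * g j)\<^sup>2 / (\<Sum>j\<in>Y. W i j))"
    and orth: "(\<Sum>i\<in>Y. (\<Sum>j\<in>Y. W i j) * g i) = 0"
  shows "(\<Sum>i\<in>Y. \<Sum>j\<in>Y. W i j * g i * g j) \<le> 0"
proof -
  \<comment> \<open>The \<open>d i\<close> are the stationary weights, \<open>P\<close> is the
    transition operator, \<open>N\<close> is the inner product weighted by \<open>d\<close> in which
    \<open>P\<close> is self-adjoint with form \<open>Q\<close>, and \<open>ort\<close> means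
    orthogonal to the constants.\<close>
  define d where "d i = (\<Sum>j\<in>Y. W i j)" for i
  define Q where "Q u w = (\<Sum>i\<in>Y. \<Sum>j\<in>Y. W i j * u i * w j)" for u w
  define N where "N u w = (\<Sum>i\<in>Y. d i * u i * w i)" for u w
  define P where "P u i = (\<Sum>j\<in>Y. W i j * u j) / d i" for u i
  define ort where "ort u \<longleftrightarrow> (\<Sum>i\<in>Y. d i * u i) = 0" for u
  have dpos: "d i > 0" if "i \<in> Y" for i using pos that by (simp add: d_def)
  have dnz: "d i \<noteq> 0" if "i \<in> Y" for i using dpos[OF that] by simp
  have Qsym: "Q u w = Q w u" for u w
    unfolding Q_def by (subst sum.swap) (simp add: sym mult_ac cong: sum.cong)
  have QP: "Q u w = N u (P w)" for u w
  proof -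
    have "d i * u i * ((\<Sum>j\<in>Y. W i j * w j) / d i) = (\<Sum>j\<in>Y. W i j * u i * w j)" if "i \<in> Y" for i
    proof -
      have "d i * u i * ((\<Sum>j\<in>Y. W i j * w j) / d i) = u i * (\<Sum>j\<in>Y. W i j * w j)"
        using dnz[OF that] by simp
      then show ?thesis by (simp add: sum_distrib_left mult_ac)
    qed
    then show ?thesis by (simp add: Q_def N_def P_def)
  qed
  have Nsym: "N u w = N w u" for u w by (simp add: N_def mult_ac)
  have boch: "Q u u \<le> N (P u) (P u)" for u
  proof -
    have "N (P u) (P u) = (\<Sum>i\<in>Y. (\<Sum>j\<in>Y. W i j * u j)\<^sup>2 / d i)"
      unfolding N_def P_def
      by (intro sum.cong refl) (simp add: dnz power2_eq_square)
    then show ?thesis using bochner[of u] by (simp add: Q_def d_def)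
  qed
  have ortP: "ort (P u)" if "ort u" for u
  proof -
    have "(\<Sum>i\<in>Y. d i * P u i) = (\<Sum>i\<in>Y. \<Sum>j\<in>Y. W i j * u j)"
      unfolding P_def by (intro sum.cong refl) (simp add: dnz)
    also have "\<dots> = (\<Sum>j\<in>Y. \<Sum>i\<in>Y. W i j * u j)" by (rule sum.swap)
    also have "\<dots> = (\<Sum>j\<in>Y. d j * u j)"
      by (intro sum.cong refl) (simp add: d_def sym sum_distrib_right)
    finally show ?thesis using that by (simp add: ort_def)
  qed
  have Nlin: "N (\<lambda>i. u i + t * w i) (\<lambda>i. u i + t * w i) = N u u + 2 * t * N u w + t\<^sup>2 * N w w" for u w t
    unfolding N_def sum_distrib_left sum.distrib[symmetric]
    by (intro sum.cong refl) (simp add: algebra_simps power2_eq_square)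
  have Qlin: "Q (\<lambda>i. u i + t * w i) (\<lambda>i. u i + t * w i) = Q u u + 2 * t * Q u w + t\<^sup>2 * Q w w" for u w t
  proof -
    have "Q (\<lambda>i. u i + t * w i) (\<lambda>i. u i + t * w i) = Q u u + t * Q u w + t * Q w u + t\<^sup>2 * Q w w"
      unfolding Q_def sum_distrib_left sum.distrib[symmetric]
      by (intro sum.cong refl) (simp add: algebra_simps power2_eq_square)
    then show ?thesis by (simp add: Qsym[of w u])
  qed
  have Nscale: "N (\<lambda>i. t * u i) (\<lambda>i. t * u i) = t\<^sup>2 * N u u" for t u
    unfolding N_def sum_distrib_left by (intro sum.cong refl) (simp add: power2_eq_square)
  have Qscale: "Q (\<lambda>i. t * u i) (\<lambda>i. t * u i) = t\<^sup>2 * Q u u" for t u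
    unfolding Q_def sum_distrib_left by (intro sum.cong refl) (simp add: power2_eq_square)
  have Npos: "N u u \<ge> 0" for u
    unfolding N_def using dpos by (intro sum_nonneg) (simp add: less_imp_le mult.assoc)
  have Nzero: "u i = 0" if "N u u = 0" "i \<in> Y" for u i
  proof -
    have "\<forall>i\<in>Y. d i * u i * u i = 0"
      using that(1) unfolding N_def
      by (subst (asm) sum_nonneg_eq_0_iff) (use fin dpos in \<open>auto simp: less_imp_le mult.assoc\<close>)
    then show ?thesis using that(2) dpos by fastforce
  qed
  \<comment> \<open>In this form, a Rayleigh quotient of at least 1 forces equal values across every
    edge of positive weight.\<close>
  have Dirichlet: "N u u - Q u u = (\<Sum>i\<in>Y. \<Sum>j\<in>Y. W i j * (u i - u j)\<^sup>2) / 2" for u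
  proof -
    have 1: "(\<Sum>i\<in>Y. \<Sum>j\<in>Y. W i j * (u i)\<^sup>2) = N u u"
      unfolding N_def d_def by (simp add: sum_distrib_right power2_eq_square mult.assoc)
    have 2: "(\<Sum>i\<in>Y. \<Sum>j\<in>Y. W i j * (u j)\<^sup>2) = N u u"
      by (subst sum.swap) (simp add: 1 sym[of _ _] flip: 1)
    have "(\<Sum>i\<in>Y. \<Sum>j\<in>Y. W i j * (u i - u j)\<^sup>2)
       = (\<Sum>i\<in>Y. \<Sum>j\<in>Y. W i j * (u i)\<^sup>2) + (\<Sum>i\<in>Y. \<Sum>j\<in>Y. W i j * (u j)\<^sup>2) - 2 * Q u u"
      unfolding Q_def sum_distrib_left sum.distrib[symmetric] sum_subtractf[symmetric]
      by (intro sum.cong refl) (simp add: algebra_simps power2_eq_square)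
    then show ?thesis using 1 2 by simp
  qed
  \<comment> \<open>The unit sphere of \<open>N\<close> in the complement of the constants.
    Coordinates outside \<open>Y\<close> are pinned to 0 and the others are boxed, so that
    compactness comes from the product topology. On the sphere
    \<open>d i * (u i)\<^sup>2 \<le> 1\<close>, and \<open>1 + 1 / d i\<close> bounds the square
    root of \<open>1 / d i\<close>.\<close>
  define K where "K = (PiE UNIV (\<lambda>i. if i \<in> Y then {-(1 + 1 / d i)..1 + 1 / d i} else {0}))
      \<inter> {u. N u u = 1} \<inter> {u. (\<Sum>i\<in>Y. d i * u i) = 0}"
  have coord: "continuous_on UNIV (\<lambda>u::'b \<Rightarrow> real. u i)" for i
    by (rule continuous_on_product_coordinates)
  have "compact (PiE UNIV (\<lambda>i. if i \<in> Y then {-(1 + 1 / d i)..1 + 1 / d i} else {0}))"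
    using compactin_PiE[of "\<lambda>_::'b. euclideanreal" UNIV
        "\<lambda>i. if i \<in> Y then {-(1 + 1 / d i)..1 + 1 / d i} else {0}"]
    by (auto simp: euclidean_product_topology)
  moreover have "closed {u. N u u = 1}"
    unfolding N_def by (intro closed_Collect_eq continuous_intros coord)
  moreover have "closed {u. (\<Sum>i\<in>Y. d i * u i) = 0}"
    by (intro closed_Collect_eq continuous_intros coord)
  ultimately have "compact K"
    unfolding K_def by (intro compact_Int_closed)
  have Qcont: "continuous_on K (\<lambda>u. Q u u)"
    unfolding Q_def by (intro continuous_intros continuous_on_subset[OF coord]) auto
  have inK: "\<exists>w\<in>K. Q u u = N u u * Q w w" if "ort u" "N u u \<noteq> 0" for u
  proof -
    define t where "t = 1 / sqrt (N u u)"
    define w where "w i = (if i \<in> Y then t * u i else 0)" for i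
    have t: "t\<^sup>2 * N u u = 1"
      using that(2) Npos[of u] by (simp add: t_def power_divide)
    have wN: "N w w = 1"
      using Nscale[of t u] t by (simp add: N_def w_def)
    have "Q w w = t\<^sup>2 * Q u u"
      using Qscale[of t u] by (simp add: Q_def w_def)
    then have wQ: "Q u u = N u u * Q w w" using t by (metis mult.assoc mult.commute mult_1)
    have "(\<Sum>i\<in>Y. d i * w i) = t * (\<Sum>i\<in>Y. d i * u i)"
      by (simp add: w_def sum_distrib_left mult_ac)
    then have wo: "(\<Sum>i\<in>Y. d i * w i) = 0" using that(1) by (simp add: ort_def)
    have bd: "\<bar>w i\<bar> \<le> 1 + 1 / d i" if i: "i \<in> Y" for i
    proof -
      have "d i * w i * w i \<le> N w w"
        unfolding N_def using fin i dpos
        by (intro member_le_sum) (auto simp: less_imp_le mult.assoc)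
      then have "(w i)\<^sup>2 \<le> 1 / d i" using wN dpos[OF i] by (simp add: field_simps power2_eq_square)
      also have "\<dots> \<le> (1 + 1 / d i)\<^sup>2" using dpos[OF i] by (simp add: power2_eq_square field_simps)
      finally show ?thesis using dpos[OF i] by (simp add: abs_le_square_iff[symmetric])
    qed
    have "w \<in> K" unfolding K_def using wN wo bd by (auto simp: w_def abs_le_iff split: if_splits; fastforce)
    then show ?thesis using wQ by blast
  qed
  show ?thesis
  proof (cases "K = {}")
    case True
    then have "N g g = 0" using inK[of g] orth by (auto simp: ort_def d_def)
    then show ?thesis by (simp add: Nzero)
  next
    case False
    obtain g0 where g0: "g0 \<in> K" and max: "\<And>u. u \<in> K \<Longrightarrow> Q u u \<le> Q g0 g0"
      using continuous_attains_sup[OF \<open>compact K\<close> False Qcont] by blast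
    define l where "l = Q g0 g0"
    have N0: "N g0 g0 = 1" and o0: "ort g0" using g0 by (auto simp: K_def ort_def)
    have le: "Q u u \<le> l * N u u" if "ort u" for u
    proof (cases "N u u = 0")
      case True
      have "Q u u = 0" unfolding Q_def using Nzero[OF True] by simp
      with True show ?thesis by simp
    next
      case False
      from inK[OF that this] obtain w where w: "w \<in> K" "Q u u = N u u * Q w w" by blast
      have "N u u * Q w w \<le> N u u * l"
        unfolding l_def using max[OF w(1)] Npos by (intro mult_left_mono)
      then show ?thesis using w(2) by (simp add: mult.commute)
    qed
    have "l \<le> 0"
    proof (rule ccontr)
      assume "\<not> l \<le> 0"
      have ortPt: "ort (\<lambda>i. g0 i + t * P g0 i)" for t
        using o0 ortP[OF o0] by (simp add: ort_def algebra_simps sum.distrib flip: sum_distrib_left)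
      \<comment> \<open>Moving the maximiser \<open>g0\<close> by \<open>t * P g0\<close> keeps it
        orthogonal to the constants, and maximality reads
        \<open>0 \<le> 2 * t * a + t\<^sup>2 * b\<close> for all \<open>t\<close>. Hence
        \<open>a\<close> vanishes, that is, \<open>P g0\<close> has squared norm
        \<open>l * l\<close>, and \<open>boch\<close> yields \<open>l \<le> l * l\<close>.\<close>
      define a where "a = l * l - N (P g0) (P g0)"
      define b where "b = l * N (P g0) (P g0) - Q (P g0) (P g0)"
      have Q1: "Q g0 (P g0) = N (P g0) (P g0)" using QP[of "P g0" g0] Qsym by metis
      have N1: "N g0 (P g0) = l" using QP[of g0 g0] by (simp add: l_def)
      have "0 \<le> 2 * t * a + t\<^sup>2 * b" for t
        using le[OF ortPt[of t]] unfolding Nlin Qlin Q1 N1 N0 a_def b_def l_def[symmetric]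
        by (simp add: algebra_simps)
      have "b \<ge> 0" using le[OF ortP[OF o0]] by (simp add: b_def)
      have "a = 0"
      proof (rule ccontr)
        assume "a \<noteq> 0"
        \<comment> \<open>The minimiser would be \<open>- a / b\<close>; the added 1 covers
          \<open>b = 0\<close>.\<close>
        have "0 \<le> 2 * (- a / (b + 1)) * a + (- a / (b + 1))\<^sup>2 * b" by fact
        also have "\<dots> = a\<^sup>2 / (b + 1)\<^sup>2 * (- 2 * (b + 1) + b)"
        proof -
          define e where "e = b + 1"
          have e: "e \<noteq> 0" "b = e - 1" using \<open>b \<ge> 0\<close> by (auto simp: e_def)
          show ?thesis using e(1) unfolding e(2) by (simp add: field_simps power2_eq_square)
        qed
        also have "\<dots> < 0" using \<open>b \<ge> 0\<close> \<open>a \<noteq> 0\<close> by (intro mult_pos_neg) auto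
        finally show False by simp
      qed
      then have "l \<le> l * l" using boch[of g0] by (simp add: a_def l_def)
      with \<open>\<not> l \<le> 0\<close> have "1 \<le> l" by simp
      then have "(\<Sum>i\<in>Y. \<Sum>j\<in>Y. W i j * (g0 i - g0 j)\<^sup>2) \<le> 0"
        using Dirichlet[of g0] by (simp add: N0 l_def)
      moreover have "(\<Sum>i\<in>Y. \<Sum>j\<in>Y. W i j * (g0 i - g0 j)\<^sup>2) \<ge> 0"
        by (intro sum_nonneg mult_nonneg_nonneg nonneg) auto
      ultimately have "(\<Sum>i\<in>Y. \<Sum>j\<in>Y. W i j * (g0 i - g0 j)\<^sup>2) = 0" by simp
      then have "\<forall>i\<in>Y. (\<Sum>j\<in>Y. W i j * (g0 i - g0 j)\<^sup>2) = 0"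
        by (subst (asm) sum_nonneg_eq_0_iff) (auto intro!: fin sum_nonneg mult_nonneg_nonneg nonneg)
      then have row: "(\<Sum>j\<in>Y. W i j * (g0 i - g0 j)\<^sup>2) = 0" if "i \<in> Y" for i using that by blast
      have z: "W i j * (g0 i - g0 j)\<^sup>2 = 0" if "i \<in> Y" "j \<in> Y" for i j
        using row[OF that(1)] that nonneg fin by (subst (asm) sum_nonneg_eq_0_iff) auto
      have const: "g0 i = g0 j" if ij: "i \<in> Y" "j \<in> Y" for i j
      proof -
        obtain c where "c \<in> Y" "0 < W i c" "0 < W c j" using conn[OF ij] by blast
        then show ?thesis using z[OF ij(1), of c] z[OF _ ij(2), of c] by simp
      qed
      have "Y \<noteq> {}" using N0 by (auto simp: N_def)
      then obtain i where "i \<in> Y" by blast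
      have "(\<Sum>j\<in>Y. d j * g0 j) = (\<Sum>j\<in>Y. d j) * g0 i"
        unfolding sum_distrib_right by (intro sum.cong refl) (metis const \<open>i \<in> Y\<close>)
      moreover have "(\<Sum>j\<in>Y. d j) > 0" using fin \<open>Y \<noteq> {}\<close> dpos by (intro sum_pos) auto
      ultimately have "g0 i = 0" using o0 by (simp add: ort_def)
      then have "\<forall>j\<in>Y. g0 j = 0" using const \<open>i \<in> Y\<close> by metis
      then show False using N0 by (simp add: N_def)
    qed
    have "ort g" using orth by (simp add: ort_def d_def)
    from le[OF this] have "Q g g \<le> l * N g g" .
    also have "\<dots> \<le> 0" using \<open>l \<le> 0\<close> Npos[of g] by (simp add: mult_nonpos_nonneg)
    finally show ?thesis by (simp add: Q_def)
  qed
qed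

text \<open>In the induction step the first remaining direction \<open>v\<close> serves both as the vector at which the
  hyperbolicity of the links is evaluated and as the Perron eigenvector.\<close>

lemma mix_hyperbolic_pos:
  assumes fin: "finite X"
    and "\<And>\<alpha>. set_mset \<alpha> \<subseteq> X \<Longrightarrow> 0 \<le> \<Phi> \<alpha>"
    and "\<And>\<alpha>. set_mset \<alpha> \<subseteq> X \<Longrightarrow> size \<alpha> = length vs \<Longrightarrow>
      hyperbolic (\<lambda>u w. mix X (\<lambda>\<beta>. \<Phi> (\<alpha> + \<beta>)) [u, w])"
    and "\<And>\<alpha> i j k. set_mset \<alpha> \<subseteq> X \<Longrightarrow> i \<in> X \<Longrightarrow> j \<in> X \<Longrightarrow> size \<alpha> + k + 1 = length vs \<Longrightarrow>
      extendible X \<Phi> (k + 2) (add_mset i \<alpha>) \<Longrightarrow> extendible X \<Phi> (k + 2) (add_mset j \<alpha>) \<Longrightarrow>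
      \<exists>c\<in>X. extendible X \<Phi> (k + 1) (add_mset i (add_mset c \<alpha>)) \<and>
        extendible X \<Phi> (k + 1) (add_mset c (add_mset j \<alpha>))"
    and "\<And>v i. v \<in> set vs \<Longrightarrow> i \<in> X \<Longrightarrow> 0 < v i"
  shows "hyperbolic (\<lambda>u w. mix X \<Phi> (u # w # vs))"
  using assms(2-)
proof (induction vs arbitrary: \<Phi>)
  case Nil
  then show ?case using Nil.prems(2)[of "{#}"] by simp
next
  case (Cons v vs)
  note nonneg = Cons.prems(1) and local_hyp = Cons.prems(2) and conn = Cons.prems(3)
  have vpos: "0 < v i" if "i \<in> X" for i using Cons.prems(4) that by simp
  have vspos: "0 < w i" if "w \<in> set (v # vs)" "i \<in> X" for w i using Cons.prems(4) that by blast
  define L where "L i = (\<lambda>\<alpha>. \<Phi> (add_mset i \<alpha>))" for i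
  define M where "M i j = mix X (\<lambda>\<alpha>. \<Phi> (add_mset i (add_mset j \<alpha>))) (v # vs)" for i j
  define b where "b i u = mix X (L i) (u # v # vs)" for i u
  define B where "B u w = mix X \<Phi> (u # w # v # vs)" for u w
  \<comment> \<open>A derivative along \<open>i\<close> moves into the base multiset: the hypotheses
    for \<open>L i\<close> are those for \<Phi> at \<open>add_mset i \<alpha>\<close>, with one
    direction fewer.\<close>
  have IH: "hyperbolic (\<lambda>u w. mix X (L i) (u # w # vs))" if i: "i \<in> X" for i
  proof (rule Cons.IH)
    show "0 \<le> L i \<alpha>" if "set_mset \<alpha> \<subseteq> X" for \<alpha> using nonneg that i by (simp add: L_def)
    show "hyperbolic (\<lambda>u w. mix X (\<lambda>\<beta>. L i (\<alpha> + \<beta>)) [u, w])"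
      if "set_mset \<alpha> \<subseteq> X" "size \<alpha> = length vs" for \<alpha>
      using local_hyp[of "add_mset i \<alpha>"] that i by (simp add: L_def)
    show "\<exists>c\<in>X. extendible X (L i) (k + 1) (add_mset i' (add_mset c \<alpha>)) \<and>
        extendible X (L i) (k + 1) (add_mset c (add_mset j \<alpha>))"
      if "set_mset \<alpha> \<subseteq> X" "i' \<in> X" "j \<in> X" "size \<alpha> + k + 1 = length vs"
        "extendible X (L i) (k + 2) (add_mset i' \<alpha>)" "extendible X (L i) (k + 2) (add_mset j \<alpha>)"
      for \<alpha> i' j k
      using conn[of "add_mset i \<alpha>" i' j k] that i
      by (simp add: L_def extendible_link add_mset_commute)
    show "0 < w i" if "w \<in> set vs" "i \<in> X" for w i using vspos that by simp
  qed
  have Msym: "M i j = M j i" for i j by (simp add: M_def add_mset_commute)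
  have Mnonneg: "0 \<le> M i j" if "i \<in> X" "j \<in> X" for i j
    unfolding M_def using that nonneg vspos by (intro mix_nonneg) (auto simp: less_imp_le)
  have Mpos: "0 < M i j \<longleftrightarrow> extendible X \<Phi> (Suc (length vs)) {#i, j#}" if "i \<in> X" "j \<in> X" for i j
    unfolding M_def using that nonneg vspos
    by (subst mix_pos_iff[OF fin]) (auto simp: extendible_def)
  have b: "b i u = (\<Sum>j\<in>X. u j * M i j)" for i u by (simp add: b_def M_def L_def)
  have Bb: "B u w = (\<Sum>i\<in>X. u i * b i w)" for u w by (simp add: B_def b_def L_def)
  have Bsym: "B u w = B w u" for u w unfolding B_def by (rule mix_swap)
  have Blin: "B (\<lambda>i. u i + t * w i) z = B u z + t * B w z" for u w z t
    unfolding B_def by (rule mix_linear)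
  \<comment> \<open>By symmetry the direction \<open>v\<close> can be expanded before both copies of
    \<open>u\<close>, which writes the form as a \<open>v\<close>-weighted sum of the forms of the
    links.\<close>
  have Bmix: "B u u = (\<Sum>i\<in>X. v i * mix X (L i) (u # u # vs))" for u
    unfolding B_def mix_rotate[of X \<Phi> v u u vs, symmetric] mix.simps(2)[of X \<Phi> v] L_def ..
  have bpos: "0 < b i v \<longleftrightarrow> extendible X \<Phi> (length vs + 2) {#i#}" if "i \<in> X" for i
    unfolding b_def L_def using that nonneg vspos
    by (subst mix_pos_iff[OF fin]) (auto simp: extendible_link)
  have bnonneg: "0 \<le> b i v" if "i \<in> X" for i
    unfolding b using that Mnonneg vpos by (intro sum_nonneg) (simp add: less_imp_le)
  \<comment> \<open>The indices whose row in the second derivative is nonzero. The form ignores all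
    others, and on \<open>Y\<close> the row sums are positive.\<close>
  define Y where "Y = {i \<in> X. 0 < b i v}"
  have YX: "Y \<subseteq> X" and finY: "finite Y" using fin by (auto simp: Y_def)
  have mix0: "mix X (L i) us = 0" if i: "i \<in> X" "i \<notin> Y" and "length us = length vs + 2" for i us
  proof (rule mix_eq_0)
    fix \<alpha> assume \<alpha>: "set_mset \<alpha> \<subseteq> X" "size \<alpha> = length us"
    have "\<not> extendible X \<Phi> (length vs + 2) {#i#}" using i bpos by (simp add: Y_def)
    then have "\<not> 0 < \<Phi> (add_mset i \<alpha>)" using \<alpha> that by (simp add: extendible_def)
    with nonneg[of "add_mset i \<alpha>"] i \<alpha> show "L i \<alpha> = 0" by (simp add: L_def)
  qed
  have M0: "M i j = 0" if i: "i \<in> X" "i \<notin> Y" and j: "j \<in> X" for i j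
  proof -
    have "(\<Sum>j\<in>X. v j * M i j) = 0" using mix0[OF i, of "v # v # vs"] b[of i v] by (simp add: b_def)
    then have "v j * M i j = 0"
      using i j vpos Mnonneg fin by (subst (asm) sum_nonneg_eq_0_iff) (auto simp: less_imp_le)
    then show ?thesis using vpos[OF j] by simp
  qed
  have bY: "b i u = (\<Sum>j\<in>Y. u j * M i j)" if "i \<in> X" for i u
    unfolding b using that YX fin M0 Msym by (intro sum.mono_neutral_right) auto
  have b0: "b i u = 0" if "i \<in> X" "i \<notin> Y" for i u
    unfolding b using that M0 by simp
  have BY: "B u w = (\<Sum>i\<in>Y. u i * b i w)" for u w
    unfolding Bb using YX fin b0 by (intro sum.mono_neutral_right) auto
  have "hyperbolic B"
  proof (cases "Y = {}")
    case True
    then show ?thesis by (simp add: hyperbolic_def BY)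
  next
    case False
    show ?thesis
    proof (rule hyperbolicI[of B v, OF Bsym Blin])
      show "0 < B v v"
        unfolding BY using False finY YX vpos by (intro sum_pos) (auto simp: Y_def)
    next
      fix u assume orth: "B u v = 0"
      \<comment> \<open>Rescaling by \<open>v\<close> turns \<open>v\<close> into the constant
        function 1: the row sums become \<open>v i * b i v\<close>, and orthogonality of
        \<open>u\<close> to \<open>v\<close> becomes orthogonality of \<open>u / v\<close> to the
        constants.\<close>
      define W where "W i j = v i * M i j * v j" for i j
      have Wsum: "(\<Sum>j\<in>Y. W i j * g j) = v i * b i (\<lambda>j. v j * g j)" if "i \<in> Y" for i g
        using that YX by (simp add: bY subsetD W_def sum_distrib_left mult_ac)
      have Wrow: "(\<Sum>j\<in>Y. W i j) = v i * b i v" if "i \<in> Y" for i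
        using Wsum[OF that, of "\<lambda>_. 1"] by simp
      have Wform: "(\<Sum>i\<in>Y. \<Sum>j\<in>Y. W i j * g i * g j) = B (\<lambda>j. v j * g j) (\<lambda>j. v j * g j)" for g
      proof -
        have "(\<Sum>i\<in>Y. \<Sum>j\<in>Y. W i j * g i * g j) = (\<Sum>i\<in>Y. g i * (\<Sum>j\<in>Y. W i j * g j))"
          by (simp add: sum_distrib_left mult_ac)
        also have "\<dots> = B (\<lambda>j. v j * g j) (\<lambda>j. v j * g j)"
          unfolding BY by (intro sum.cong refl) (simp add: Wsum)
        finally show ?thesis .
      qed
      have "(\<Sum>i\<in>Y. \<Sum>j\<in>Y. W i j * (u i / v i) * (u j / v j)) \<le> 0"
      proof (rule reversible_form_nonpos[OF finY])
        show "W i j = W j i" for i j using Msym by (simp add: W_def mult_ac)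
        show "0 \<le> W i j" if "i \<in> Y" "j \<in> Y" for i j
          unfolding W_def using that YX Mnonneg vpos by (auto simp: less_imp_le subsetD)
        show "0 < (\<Sum>j\<in>Y. W i j)" if "i \<in> Y" for i
          unfolding Wrow[OF that] using that YX vpos by (auto simp: Y_def)
        show "\<exists>c\<in>Y. 0 < W i c \<and> 0 < W c j" if ij: "i \<in> Y" "j \<in> Y" for i j
        proof -
          have "extendible X \<Phi> (length vs + 2) {#i#}" "extendible X \<Phi> (length vs + 2) {#j#}"
            using ij bpos by (auto simp: Y_def)
          then obtain c where c: "c \<in> X" "extendible X \<Phi> (length vs + 1) {#i, c#}"
            "extendible X \<Phi> (length vs + 1) {#c, j#}"
            using conn[of "{#}" i j "length vs"] ij YX by auto
          then have "0 < M i c" "0 < M c j" using Mpos ij YX by (auto simp: subsetD)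
          moreover from this have "c \<in> Y" using M0[of c j] c ij YX by auto
          ultimately show ?thesis using ij YX vpos unfolding W_def
            by (intro bexI[of _ c] conjI mult_pos_pos) auto
        qed
        show "(\<Sum>i\<in>Y. \<Sum>j\<in>Y. W i j * g i * g j) \<le> (\<Sum>i\<in>Y. (\<Sum>j\<in>Y. W i j * g j)\<^sup>2 / (\<Sum>j\<in>Y. W i j))" for g
        proof -
          define z where "z j = v j * g j" for j
          have "(\<Sum>i\<in>Y. \<Sum>j\<in>Y. W i j * g i * g j) = B z z" unfolding Wform z_def ..
          also have "\<dots> = (\<Sum>i\<in>Y. v i * mix X (L i) (z # z # vs))"
            unfolding Bmix using YX fin by (intro sum.mono_neutral_right) (simp_all add: mix0 del: mix.simps)
          \<comment> \<open>Hyperbolicity of each link at the pair \<open>z\<close>,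
            \<open>v\<close>. Weighted by \<open>v i\<close> and summed, it is the Bochner
            inequality for \<open>W\<close>.\<close>
          also have "\<dots> \<le> (\<Sum>i\<in>Y. v i * ((b i z)\<^sup>2 / b i v))"
          proof (intro sum_mono mult_left_mono)
            fix i assume i: "i \<in> Y"
            then have "i \<in> X" "0 < b i v" by (auto simp: Y_def)
            then have "mix X (L i) (z # z # vs) * b i v \<le> (b i z)\<^sup>2"
              using IH[OF \<open>i \<in> X\<close>] unfolding hyperbolic_def b_def by (simp add: less_imp_le)
            then show "mix X (L i) (z # z # vs) \<le> (b i z)\<^sup>2 / b i v"
              using \<open>0 < b i v\<close> by (simp add: pos_le_divide_eq)
            show "0 \<le> v i" using vpos \<open>i \<in> X\<close> by (simp add: less_imp_le)
          qed
          also have "\<dots> = (\<Sum>i\<in>Y. (\<Sum>j\<in>Y. W i j * g j)\<^sup>2 / (\<Sum>j\<in>Y. W i j))"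
          proof (intro sum.cong refl)
            fix i assume i: "i \<in> Y"
            then have "v i \<noteq> 0" using vpos[of i] YX by auto
            then show "v i * ((b i z)\<^sup>2 / b i v) = (\<Sum>j\<in>Y. W i j * g j)\<^sup>2 / (\<Sum>j\<in>Y. W i j)"
              unfolding Wsum[OF i] Wrow[OF i] z_def[symmetric] by (simp add: power2_eq_square)
          qed
          finally show ?thesis .
        qed
        show "(\<Sum>i\<in>Y. (\<Sum>j\<in>Y. W i j) * (u i / v i)) = 0"
        proof -
          have "(\<Sum>i\<in>Y. (\<Sum>j\<in>Y. W i j) * (u i / v i)) = (\<Sum>i\<in>Y. u i * b i v)"
          proof (intro sum.cong refl)
            fix i assume i: "i \<in> Y"
            then have "v i \<noteq> 0" using vpos[of i] YX by auto
            then show "(\<Sum>j\<in>Y. W i j) * (u i / v i) = u i * b i v"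
              unfolding Wrow[OF i] by simp
          qed
          then show ?thesis using orth by (simp add: BY)
        qed
      qed
      moreover have "B (\<lambda>j. v j * (u j / v j)) (\<lambda>j. v j * (u j / v j)) = B u u"
      proof -
        have eq: "v j * (u j / v j) = u j" if "j \<in> Y" for j using vpos[of j] that YX by auto
        have "b i (\<lambda>j. v j * (u j / v j)) = b i u" if "i \<in> Y" for i
          using that YX by (simp add: bY subsetD eq del: times_divide_eq_right)
        then show ?thesis unfolding BY by (intro sum.cong refl) (simp add: eq del: times_divide_eq_right)
      qed
      ultimately show "B u u \<le> 0" unfolding Wform by simp
    qed
  qed
  then show ?case unfolding B_def .
qed

section \<open>Nonnegative directions by continuity\<close>

lemma isCont_mix:
  assumes "\<And>v i. v \<in> set vs \<Longrightarrow> isCont (\<lambda>e. v e i) (x::real)"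
  shows "isCont (\<lambda>e. mix X \<Phi> (map (\<lambda>v. v e) vs)) x"
  using assms by (induction vs arbitrary: \<Phi>) (auto intro!: continuous_intros)

text \<open>Shifting every direction in \<open>vs\<close> by \<open>e > 0\<close> makes it strictly
  positive, and the inequality survives the limit \<open>e \<rightarrow> 0\<close>. Nonnegativity of
  \<open>w\<close> ensures \<open>0 \<le> mix X \<Phi> (w # w # ws e)\<close> for each
  \<open>e\<close>, the premise under which hyperbolicity can be applied.\<close>

lemma mix_hyperbolic:
  assumes fin: "finite X"
    and nonneg: "\<And>\<alpha>. set_mset \<alpha> \<subseteq> X \<Longrightarrow> 0 \<le> \<Phi> \<alpha>"
    and local_hyp: "\<And>\<alpha>. set_mset \<alpha> \<subseteq> X \<Longrightarrow> size \<alpha> = length vs \<Longrightarrow>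
      hyperbolic (\<lambda>u w. mix X (\<lambda>\<beta>. \<Phi> (\<alpha> + \<beta>)) [u, w])"
    and conn: "\<And>\<alpha> i j k. set_mset \<alpha> \<subseteq> X \<Longrightarrow> i \<in> X \<Longrightarrow> j \<in> X \<Longrightarrow> size \<alpha> + k + 1 = length vs \<Longrightarrow>
      extendible X \<Phi> (k + 2) (add_mset i \<alpha>) \<Longrightarrow> extendible X \<Phi> (k + 2) (add_mset j \<alpha>) \<Longrightarrow>
      \<exists>c\<in>X. extendible X \<Phi> (k + 1) (add_mset i (add_mset c \<alpha>)) \<and>
        extendible X \<Phi> (k + 1) (add_mset c (add_mset j \<alpha>))"
    and vs: "\<And>v i. v \<in> set vs \<Longrightarrow> i \<in> X \<Longrightarrow> 0 \<le> v i"
    and w: "\<And>i. i \<in> X \<Longrightarrow> 0 \<le> w i"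
  shows "mix X \<Phi> (u # u # vs) * mix X \<Phi> (w # w # vs) \<le> (mix X \<Phi> (u # w # vs))\<^sup>2"
proof -
  define ws where "ws e = map (\<lambda>v i. v i + e) vs" for e :: real
  have cont: "isCont (\<lambda>e. mix X \<Phi> (a # b # ws e)) 0" for a b
  proof -
    have "isCont (\<lambda>e. mix X \<Phi> (map (\<lambda>v. v e) ((\<lambda>_. a) # (\<lambda>_. b) # map (\<lambda>v e i. v i + e) vs))) 0"
      by (rule isCont_mix) (auto intro!: continuous_intros)
    then show ?thesis by (simp add: ws_def comp_def)
  qed
  have ws0: "ws 0 = vs" by (simp add: ws_def)
  have lim: "((\<lambda>e. mix X \<Phi> (a # b # ws e)) \<longlongrightarrow> mix X \<Phi> (a # b # vs)) (at_right 0)" for a b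
    using cont[of a b] ws0 by (auto simp: isCont_def intro: filterlim_at_split[THEN iffD1, THEN conjunct2])
  show ?thesis
  proof (rule tendsto_le[OF _ tendsto_power[OF lim] tendsto_mult[OF lim lim]])
    show "at_right (0::real) \<noteq> bot" by simp
    have "mix X \<Phi> (u # u # ws e) * mix X \<Phi> (w # w # ws e) \<le> (mix X \<Phi> (u # w # ws e))\<^sup>2" if "0 < e" for e
    proof -
      have "hyperbolic (\<lambda>u w. mix X \<Phi> (u # w # ws e))"
        by (rule mix_hyperbolic_pos[OF fin nonneg])
          (use local_hyp conn vs that in \<open>auto simp: ws_def add_nonneg_pos\<close>)
      moreover have "0 \<le> mix X \<Phi> (w # w # ws e)"
        by (rule mix_nonneg[OF nonneg]) (use w vs that in \<open>auto simp: ws_def\<close>)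
      ultimately show ?thesis by (simp add: hyperbolic_def)
    qed
    then show "\<forall>\<^sub>F e in at_right 0. mix X \<Phi> (u # u # ws e) * mix X \<Phi> (w # w # ws e) \<le> (mix X \<Phi> (u # w # ws e))\<^sup>2"
      by (auto simp: eventually_at_right_less intro: eventually_mono[OF eventually_at_right_less])
  qed
qed

section \<open>Independent sets of a matroid\<close>

text \<open>The double sum is the sum of the squares of the sums over the fibres of
  \<open>f\<close>, and there are at most \<open>card R\<close> fibres; Cauchy-Schwarz does the
  rest.\<close>

lemma sum_squared_le_classes:
  fixes u :: "'a \<Rightarrow> real"
  assumes "finite R"
  shows "(\<Sum>i\<in>R. u i)\<^sup>2 \<le> card R * (\<Sum>i\<in>R. \<Sum>j\<in>R. if f i = f j then u i * u j else 0)"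
proof -
  define x where "x c = (\<Sum>i | i \<in> R \<and> f i = c. u i)" for c
  have "(\<Sum>i\<in>R. u i) = (\<Sum>c\<in>f ` R. x c)"
    unfolding x_def using assms by (rule sum.image_gen)
  then have "(\<Sum>i\<in>R. u i)\<^sup>2 \<le> real (card (f ` R)) * (\<Sum>c\<in>f ` R. (x c)\<^sup>2)"
    using sum_squared_le_sum_of_squares[of x "f ` R"] by (simp add: mult.commute)
  also have "\<dots> \<le> real (card R) * (\<Sum>c\<in>f ` R. (x c)\<^sup>2)"
    using assms by (intro mult_right_mono) (auto simp: card_image_le sum_nonneg)
  also have "(\<Sum>c\<in>f ` R. (x c)\<^sup>2) = (\<Sum>i\<in>R. \<Sum>j\<in>R. if f i = f j then u i * u j else 0)"
  proof -
    have "(\<Sum>j\<in>R. if f i = f j then u i * u j else 0) = u i * x (f i)" for i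
      unfolding x_def sum_distrib_left
      by (simp add: sum.inter_filter[OF assms] eq_commute[of "f i"])
    then have "(\<Sum>i\<in>R. \<Sum>j\<in>R. if f i = f j then u i * u j else 0) = (\<Sum>i\<in>R. u i * x (f i))"
      by simp
    also have "\<dots> = (\<Sum>c\<in>f ` R. \<Sum>i | i \<in> R \<and> f i = c. u i * x (f i))"
      using assms by (rule sum.image_gen)
    also have "\<dots> = (\<Sum>c\<in>f ` R. (x c)\<^sup>2)"
      by (intro sum.cong refl) (auto simp: x_def power2_eq_square sum_distrib_right intro!: sum.cong)
    finally show ?thesis by simp
  qed
  finally show ?thesis .
qed

context matroid
begin

lemma indep_finite: "I \<in> \<I> \<Longrightarrow> finite I"
  using indep_subset_ground finite_ground finite_subset by blast

section \<open>The homogenised generating polynomial of the independent sets\<close>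

definition atoms :: "'a option set" where
  "atoms = insert None (Some ` E)"

definition selected :: "'a option multiset \<Rightarrow> 'a set" where
  "selected \<alpha> = {i. Some i \<in># \<alpha>}"

text \<open>These are exactly the orders of the nonzero derivatives of the generating polynomial: it
  is affine in each x_i, and an independent set within the degree bound is itself a surviving
  term.\<close>

definition admissible :: "'a option multiset \<Rightarrow> bool" where
  "admissible \<alpha> \<longleftrightarrow> size \<alpha> \<le> card E \<and> (\<forall>i. count \<alpha> (Some i) \<le> 1) \<and> selected \<alpha> \<in> \<I>"

text \<open>The derivatives of \<open>f = \<Sum>I\<in>\<I>. x\<^sup>I y ^ (card E - card I)\<close>; \<open>None\<close> stands for \<open>y\<close> and \<open>Some i\<close> for \<open>x\<^sub>i\<close>.\<close>

definition deriv_coeff :: "'a option multiset \<Rightarrow> real" where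
  "deriv_coeff \<alpha> = (if size \<alpha> = card E \<and> admissible \<alpha> then fact (count \<alpha> None) else 0)"

lemma finite_atoms: "finite atoms"
  using finite_ground by (simp add: atoms_def)

lemma deriv_coeff_nonneg: "0 \<le> deriv_coeff \<alpha>"
  by (simp add: deriv_coeff_def)

lemma deriv_coeff_pos_iff: "0 < deriv_coeff \<alpha> \<longleftrightarrow> size \<alpha> = card E \<and> admissible \<alpha>"
  by (simp add: deriv_coeff_def)

lemma admissible_subset: "admissible \<beta> \<Longrightarrow> \<alpha> \<subseteq># \<beta> \<Longrightarrow> admissible \<alpha>"
  unfolding admissible_def selected_def
  using size_mset_mono[of \<alpha> \<beta>]
  by (auto intro: hereditary order_trans dest: mset_subset_eq_count mset_subset_eqD
      elim!: hereditary order_trans[rotated])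

lemma admissible_replicate_None:
  "admissible \<alpha> \<Longrightarrow> size \<alpha> + k \<le> card E \<Longrightarrow> admissible (\<alpha> + replicate_mset k None)"
  by (simp add: admissible_def selected_def)

lemma selected_add [simp]:
  "selected (add_mset None \<alpha>) = selected \<alpha>"
  "selected (add_mset (Some i) \<alpha>) = insert i (selected \<alpha>)"
  by (auto simp: selected_def)

lemma admissible_add_None:
  "admissible (add_mset None \<alpha>) \<longleftrightarrow> admissible \<alpha> \<and> size \<alpha> < card E"
  by (auto simp: admissible_def)

lemma admissible_add_Some:
  "admissible (add_mset (Some i) \<alpha>) \<longleftrightarrow>
    admissible \<alpha> \<and> size \<alpha> < card E \<and> i \<notin> selected \<alpha> \<and> insert i (selected \<alpha>) \<in> \<I>"
proof -
  have "(\<forall>j. count (add_mset (Some i) \<alpha>) (Some j) \<le> 1)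
      \<longleftrightarrow> (\<forall>j. count \<alpha> (Some j) \<le> 1) \<and> i \<notin> selected \<alpha>"
  proof -
    have "i \<notin> selected \<alpha> \<longleftrightarrow> count \<alpha> (Some i) = 0"
      by (simp add: selected_def not_in_iff)
    then show ?thesis by (auto simp: le_Suc_eq split: if_splits)
  qed
  moreover have "selected \<alpha> \<in> \<I>" if "insert i (selected \<alpha>) \<in> \<I>"
    using that by (rule hereditary) auto
  ultimately show ?thesis by (auto simp: admissible_def)
qed

lemma finite_selected: "finite (selected \<alpha>)"
proof (rule finite_subset)
  show "selected \<alpha> \<subseteq> the ` set_mset \<alpha>" by (force simp: selected_def)
qed simp

lemma size_eq_count_None:
  "admissible \<alpha> \<Longrightarrow> size \<alpha> = count \<alpha> None + card (selected \<alpha>)"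
proof (induction \<alpha>)
  case empty
  then show ?case by (simp add: selected_def)
next
  case (add a \<alpha>)
  then show ?case
    by (cases a) (auto simp: admissible_add_None admissible_add_Some finite_selected)
qed

text \<open>With \<open>S\<close> selected and \<open>q\<close> derivatives along y taken, the
  remaining quadratic is \<open>(q + 2)! / 2 * y^2 + (q + 1)! * y * x(R) + q! * e\<close>. Here
  \<open>R\<close> is the set of nonloops of the contraction by \<open>S\<close>, x(R) is the sum of
  its variables, and e is the sum of x_i x_j over the unordered nonparallel pairs in
  \<open>R\<close>. Since \<open>R\<close> lies in \<open>E - S\<close>, it has at most
  \<open>q + 2\<close> elements.\<close>

lemma deriv_coeff_hyperbolic:
  assumes P: "size P + 2 = card E"
  shows "hyperbolic (\<lambda>u w. mix atoms (\<lambda>\<beta>. deriv_coeff (P + \<beta>)) [u, w])"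
proof (cases "admissible P")
  case False
  then have "deriv_coeff (add_mset a (add_mset b P)) = 0" for a b
    by (cases a; cases b) (auto simp: deriv_coeff_def admissible_add_None admissible_add_Some)
  then show ?thesis by (simp add: hyperbolic_def)
next
  case True
  define S where "S = selected P"
  define q where "q = count P None"
  define R where "R = {i \<in> E - S. insert i S \<in> \<I>}"
  have S: "S \<in> \<I>" using True by (simp add: admissible_def S_def)
  have finS: "finite S" and SE: "S \<subseteq> E" using S indep_finite indep_subset_ground by auto
  have finR: "finite R" and RE: "R \<subseteq> E" using finite_ground by (auto simp: R_def)
  have sz: "q + 2 + card S = card E"
    using size_eq_count_None[OF True] P by (simp add: q_def S_def)
  have cardR: "card R \<le> q + 2"
  proof -
    have "card R \<le> card (E - S)" using finite_ground by (intro card_mono) (auto simp: R_def)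
    also have "\<dots> = q + 2" using sz SE finS by (simp add: card_Diff_subset)
    finally show ?thesis .
  qed
  define par where "par i j \<longleftrightarrow> i = j \<or> insert i (insert j S) \<notin> \<I>" for i j
  have par_sym: "par i j \<longleftrightarrow> par j i" for i j by (auto simp: par_def insert_commute)
  \<comment> \<open>If \<open>i\<close> and \<open>k\<close> were not parallel, augmenting
    \<open>insert j S\<close> from \<open>insert i (insert k S)\<close> would make \<open>j\<close>
    nonparallel to one of them.\<close>
  have par_trans: "par i k" if "par i j" "par j k" "i \<in> R" "j \<in> R" "k \<in> R" for i j k
  proof (rule ccontr)
    assume "\<not> par i k"
    then have ik: "i \<noteq> k" "insert i (insert k S) \<in> \<I>" by (auto simp: par_def)
    then have "i \<noteq> j" "j \<noteq> k" using that by (auto simp: par_def insert_commute)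
    have "card (insert j S) < card (insert i (insert k S))"
      using ik that finS by (simp add: R_def)
    with augmentation[of "insert j S" "insert i (insert k S)"] ik that
    obtain e where "e \<in> {i, k}" "insert e (insert j S) \<in> \<I>" by (auto simp: R_def)
    then show False using that \<open>i \<noteq> j\<close> \<open>j \<noteq> k\<close> by (auto simp: par_def insert_commute)
  qed
  define cls where "cls i = {j \<in> R. par i j}" for i
  have cls: "cls i = cls j \<longleftrightarrow> par i j" if "i \<in> R" "j \<in> R" for i j
  proof
    assume "cls i = cls j"
    moreover have "j \<in> cls j" using that by (simp add: cls_def par_def)
    ultimately show "par i j" by (auto simp: cls_def)
  next
    assume "par i j"
    then show "cls i = cls j" using that par_trans par_sym unfolding cls_def by blast
  qed
  define D where "D a b = deriv_coeff (add_mset a (add_mset b P))" for a b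
  have Dsym: "D a b = D b a" for a b by (simp add: D_def add_mset_commute)
  have D00: "D None None = fact (q + 2)"
    using P True by (simp add: D_def deriv_coeff_def admissible_add_None q_def)
  have D01: "D None (Some i) = (if i \<in> R then fact (q + 1) else 0)" if "i \<in> E" for i
    using P True that
    by (auto simp: D_def deriv_coeff_def admissible_add_None admissible_add_Some q_def R_def S_def)
  have D11: "D (Some i) (Some j) = (if i \<in> R \<and> j \<in> R \<and> \<not> par i j then fact q else 0)"
    if "i \<in> E" "j \<in> E" for i j
  proof -
    have "insert i S \<in> \<I>" "insert j S \<in> \<I>" if "insert i (insert j S) \<in> \<I>"
      using that by (auto elim: hereditary)
    then show ?thesis using P True that
      by (auto simp: D_def deriv_coeff_def admissible_add_Some q_def R_def par_def S_def)
  qed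
  define B where "B u w = mix atoms (\<lambda>\<beta>. deriv_coeff (P + \<beta>)) [u, w]" for u w
  have BD: "B u w = (\<Sum>a\<in>atoms. \<Sum>b\<in>atoms. u a * w b * D a b)" for u w
    by (simp add: B_def D_def sum_distrib_left mult.assoc)
  have sum_atoms: "(\<Sum>a\<in>atoms. g a) = g None + (\<Sum>i\<in>E. g (Some i))" for g :: "'a option \<Rightarrow> real"
    unfolding atoms_def using finite_ground by (simp add: sum.reindex)
  have ER: "(\<Sum>i\<in>E. g i) = (\<Sum>i\<in>R. g i)" if "\<And>i. i \<in> E - R \<Longrightarrow> g i = 0" for g :: "'a \<Rightarrow> real"
    using RE finite_ground that by (intro sum.mono_neutral_right) auto
  define h :: "'a option \<Rightarrow> real" where "h a = (if a = None then 1 else 0)" for a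
  have Bh: "B u h = fact (q + 2) * u None + fact (q + 1) * (\<Sum>i\<in>R. u (Some i))" for u
  proof -
    have "B u h = (\<Sum>a\<in>atoms. u a * D a None)"
      unfolding BD by (subst sum_atoms) (simp add: h_def)
    also have "\<dots> = fact (q + 2) * u None + (\<Sum>i\<in>E. u (Some i) * D (Some i) None)"
      by (simp only: sum_atoms D00 mult.commute)
    also have "(\<Sum>i\<in>E. u (Some i) * D (Some i) None) = (\<Sum>i\<in>E. if i \<in> R then fact (q + 1) * u (Some i) else 0)"
      by (intro sum.cong refl) (simp add: Dsym[of _ None] D01)
    also have "\<dots> = (\<Sum>i\<in>R. fact (q + 1) * u (Some i))"
      by (subst ER) auto
    finally show ?thesis by (simp add: sum_distrib_left)
  qed
  \<comment> \<open>The multiple of \<open>B u h\<close> is split off because it vanishes on the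
    complement of \<open>h\<close>. The last bracket is the squared total minus the sum of the
    squared class sums.\<close>
  have Buu: "B u u = u None * B u h + fact (q + 1) * u None * (\<Sum>i\<in>R. u (Some i))
      + fact q * ((\<Sum>i\<in>R. u (Some i))\<^sup>2
        - (\<Sum>i\<in>R. \<Sum>j\<in>R. if cls i = cls j then u (Some i) * u (Some j) else 0))" for u
  proof -
    have "B u u = (\<Sum>b\<in>atoms. u None * u b * D None b)
      + (\<Sum>i\<in>E. \<Sum>b\<in>atoms. u (Some i) * u b * D (Some i) b)"
      unfolding BD by (simp only: sum_atoms)
    also have "(\<Sum>b\<in>atoms. u None * u b * D None b) = u None * (\<Sum>b\<in>atoms. u b * D b None)"
      by (simp add: sum_distrib_left mult_ac Dsym[of None])
    also have "(\<Sum>b\<in>atoms. u b * D b None) = B u h"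
      unfolding BD by (subst sum_atoms) (simp add: h_def sum_atoms)
    also have "(\<Sum>i\<in>E. \<Sum>b\<in>atoms. u (Some i) * u b * D (Some i) b)
      = u None * (\<Sum>i\<in>E. u (Some i) * D None (Some i))
        + (\<Sum>i\<in>E. \<Sum>j\<in>E. u (Some i) * u (Some j) * D (Some i) (Some j))"
      by (simp add: sum_atoms sum.distrib sum_distrib_left mult_ac Dsym[of None])
    also have "(\<Sum>i\<in>E. u (Some i) * D None (Some i)) = (\<Sum>i\<in>R. u (Some i) * D None (Some i))"
      by (rule ER) (simp add: D01)
    also have "\<dots> = fact (q + 1) * (\<Sum>i\<in>R. u (Some i))"
      unfolding sum_distrib_left by (intro sum.cong refl) (use RE in \<open>auto simp: D01\<close>)
    also have "(\<Sum>i\<in>E. \<Sum>j\<in>E. u (Some i) * u (Some j) * D (Some i) (Some j))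
        = (\<Sum>i\<in>R. \<Sum>j\<in>E. u (Some i) * u (Some j) * D (Some i) (Some j))"
      by (rule ER) (simp add: D11)
    also have "\<dots> = (\<Sum>i\<in>R. \<Sum>j\<in>R. u (Some i) * u (Some j) * D (Some i) (Some j))"
      by (intro sum.cong refl ER) (use RE in \<open>auto simp: D11\<close>)
    also have "\<dots> = (\<Sum>i\<in>R. \<Sum>j\<in>R. fact q * (u (Some i) * u (Some j)
        - (if cls i = cls j then u (Some i) * u (Some j) else 0)))"
    proof (intro sum.cong refl)
      fix i j assume ij: "i \<in> R" "j \<in> R"
      with RE have "i \<in> E" "j \<in> E" by auto
      then show "u (Some i) * u (Some j) * D (Some i) (Some j) = fact q * (u (Some i) * u (Some j)
        - (if cls i = cls j then u (Some i) * u (Some j) else 0))"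
        by (simp add: ij D11 cls)
    qed
    also have "\<dots> = fact q * ((\<Sum>i\<in>R. u (Some i))\<^sup>2
        - (\<Sum>i\<in>R. \<Sum>j\<in>R. if cls i = cls j then u (Some i) * u (Some j) else 0))"
      by (simp add: power2_eq_square sum_product sum_subtractf flip: sum_distrib_left)
    finally show ?thesis by simp
  qed
  \<comment> \<open>On the orthogonal complement of \<open>y\<close> the form is nonpositive by Cauchy--Schwarz over the parallel
    classes, of which there are at most \<open>q + 2\<close>.\<close>
  have "hyperbolic B"
  proof (rule hyperbolicI)
    show "B u w = B w u" for u w unfolding B_def by (rule mix_swap)
    show "B (\<lambda>i. u i + t * w i) z = B u z + t * B w z" for u w z t
      unfolding B_def by (rule mix_linear)
    show "0 < B h h" unfolding Bh by (simp add: h_def)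
  next
    fix u assume orth: "B u h = 0"
    define x where "x = (\<Sum>i\<in>R. u (Some i))"
    define Z where "Z = (\<Sum>i\<in>R. \<Sum>j\<in>R. if cls i = cls j then u (Some i) * u (Some j) else 0)"
    have "fact (q + 2) = (real q + 2) * fact (q + 1)" by simp
    then have "B u h = fact (q + 1) * ((real q + 2) * u None + x)"
      by (simp only: Bh x_def[symmetric] distrib_left mult_ac)
    then have "(real q + 2) * u None + x = 0" using orth by simp
    then have uN: "u None = - x / (real q + 2)" by (simp add: field_simps add_eq_0_iff)
    have xZ: "x\<^sup>2 \<le> (real q + 2) * Z"
    proof -
      have "x\<^sup>2 \<le> real (card R) * Z"
        unfolding x_def Z_def by (rule sum_squared_le_classes[OF finR])
      moreover have "0 \<le> Z"
      proof (cases "R = {}")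
        case False
        then have "0 < real (card R)" using finR by (simp add: card_gt_0_iff)
        with calculation show ?thesis
          by (meson order_trans zero_le_power2 zero_le_mult_iff not_less)
      qed (simp add: Z_def)
      then have "real (card R) * Z \<le> (real q + 2) * Z"
        using cardR by (intro mult_right_mono) auto
      ultimately show ?thesis by simp
    qed
    have "B u u = fact q * ((real q + 1) * u None * x + x\<^sup>2 - Z)"
      unfolding Buu orth x_def[symmetric] Z_def[symmetric] by (simp add: algebra_simps)
    also have "(real q + 1) * u None * x + x\<^sup>2 - Z = (x\<^sup>2 - (real q + 2) * Z) / (real q + 2)"
      unfolding uN by (simp add: field_simps power2_eq_square)
    also have "fact q * \<dots> \<le> 0"
      using xZ by (intro mult_nonneg_nonpos divide_nonpos_pos) auto
    finally show "B u u \<le> 0" .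
  qed
  then show ?thesis unfolding B_def .
qed

end

section \<open>Complementary pairs of independent sets\<close>

text \<open>A strict increase from \<open>k\<close> to \<open>k + 1\<close> propagates downwards,
  because log-concavity makes the ratios of successive terms nonincreasing; \<open>pos\<close>
  permits the divisions. At the mirror index \<open>n - (k + 1)\<close> the value would then be
  smaller than \<open>c (k + 1)\<close>, against symmetry.\<close>

lemma symmetric_log_concave_le:
  fixes c :: "nat \<Rightarrow> real"
  assumes log_concave: "\<And>j. 0 < j \<Longrightarrow> j < n \<Longrightarrow> c (j - 1) * c (j + 1) \<le> (c j)\<^sup>2"
    and sym: "\<And>j. j \<le> n \<Longrightarrow> c (n - j) = c j"
    and pos: "\<And>j. 0 < c (k + 1) \<Longrightarrow> n - (k + 1) \<le> j \<Longrightarrow> j \<le> k + 1 \<Longrightarrow> 0 < c j"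
    and nonneg: "0 \<le> c k"
    and k: "n \<le> 2 * k" "k < n"
  shows "c (k + 1) \<le> c k"
proof (rule ccontr)
  assume "\<not> c (k + 1) \<le> c k"
  then have less: "c k < c (k + 1)" by simp
  have pos': "0 < c j" if "n - (k + 1) \<le> j" "j \<le> k + 1" for j
    using pos[OF _ that] less nonneg by simp
  have "c (k - d) < c (k - d + 1) \<and> c (k - d) < c (k + 1)" if "d \<le> 2 * k + 1 - n" for d
    using that
  proof (induction d)
    case (Suc d)
    define j where "j = k - d"
    have j: "0 < j" "j < n" "n - (k + 1) \<le> j - 1" "j \<le> k" using Suc.prems k by (auto simp: j_def)
    have IH: "c j < c (j + 1)" "c j < c (k + 1)" using Suc by (auto simp: j_def)
    have "c (j - 1) * c (j + 1) \<le> c j * c j" using log_concave[OF j(1,2)] by (simp add: power2_eq_square)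
    also have "\<dots> < c j * c (j + 1)" using IH(1) pos'[of j] j by (intro mult_strict_left_mono) auto
    finally have "c (j - 1) < c j"
      using pos'[of "j + 1"] j by (simp add: mult.commute mult_less_cancel_left_pos)
    moreover have "k - Suc d = j - 1" "j - 1 + 1 = j" using j by (auto simp: j_def)
    ultimately show ?case using IH by simp
  qed (use less in auto)
  from this[of "2 * k + 1 - n"] have "c (n - (k + 1)) < c (k + 1)" using k by (simp add: Suc_diff_le)
  with sym[of "k + 1"] k show False by simp
qed

section \<open>Extracting coefficients by multilinear expansion\<close>

abbreviation unit_vec :: "'b \<Rightarrow> 'b \<Rightarrow> real" where
  "unit_vec a \<equiv> (\<lambda>x. if x = a then 1 else 0)"

lemma mix_unit_vec:
  "finite X \<Longrightarrow> a \<in> X \<Longrightarrow> mix X \<Phi> (unit_vec a # vs) = mix X (\<lambda>\<alpha>. \<Phi> (add_mset a \<alpha>)) vs"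
  by (simp add: if_distrib[of "\<lambda>x. x * _"] cong: if_cong)

lemma mix_replicate:
  assumes "finite X" "a \<in> X"
  shows "mix X \<Phi> (replicate p (unit_vec a) @ vs) = mix X (\<lambda>\<alpha>. \<Phi> (replicate_mset p a + \<alpha>)) vs"
proof (induction p arbitrary: \<Phi>)
  case (Suc p)
  have "mix X \<Phi> (replicate (Suc p) (unit_vec a) @ vs)
      = mix X (\<lambda>\<alpha>. \<Phi> (add_mset a \<alpha>)) (replicate p (unit_vec a) @ vs)"
    using mix_unit_vec[OF assms] by simp
  then show ?case by (simp add: Suc.IH)
qed simp

text \<open>Multilinearity turns each sum of two coordinate directions into a choice. As
  \<open>xs\<close> is distinct, a family of choices is encoded by the set of those \<open>i\<close>
  that take the first alternative.\<close>

lemma mix_choices: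
  assumes "finite X" and "distinct xs" and "\<And>i b. i \<in> set xs \<Longrightarrow> h i b \<in> X"
  shows "mix X \<Phi> (map (\<lambda>i x. unit_vec (h i True) x + unit_vec (h i False) x) xs)
    = (\<Sum>A\<in>Pow (set xs). \<Phi> (image_mset (\<lambda>i. h i (i \<in> A)) (mset xs)))"
  using assms(2,3)
proof (induction xs arbitrary: \<Phi>)
  case (Cons x xs)
  let ?v = "map (\<lambda>i x. unit_vec (h i True) x + unit_vec (h i False) x) xs"
  have x: "x \<notin> set xs" using Cons.prems by simp
  have img: "image_mset (\<lambda>i. h i (i \<in> insert x A)) (mset xs) = image_mset (\<lambda>i. h i (i \<in> A)) (mset xs)" for A
  proof (rule image_mset_cong)
    fix i assume "i \<in># mset xs"
    then have "i \<in> insert x A \<longleftrightarrow> i \<in> A" using x by auto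
    then show "h i (i \<in> insert x A) = h i (i \<in> A)" by simp
  qed
  have "mix X \<Phi> (map (\<lambda>i x. unit_vec (h i True) x + unit_vec (h i False) x) (x # xs))
      = mix X \<Phi> ((\<lambda>y. unit_vec (h x True) y + 1 * unit_vec (h x False) y) # ?v)" by simp
  also have "\<dots> = mix X \<Phi> (unit_vec (h x True) # ?v) + 1 * mix X \<Phi> (unit_vec (h x False) # ?v)"
    by (rule mix_linear)
  also have "\<dots> = mix X (\<lambda>\<alpha>. \<Phi> (add_mset (h x True) \<alpha>)) ?v + mix X (\<lambda>\<alpha>. \<Phi> (add_mset (h x False) \<alpha>)) ?v"
    using Cons.prems(2) by (subst (1 2) mix_unit_vec[OF assms(1)]) auto
  also have "\<dots> = (\<Sum>A\<in>Pow (set xs). \<Phi> (add_mset (h x True) (image_mset (\<lambda>i. h i (i \<in> A)) (mset xs))))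
      + (\<Sum>A\<in>Pow (set xs). \<Phi> (add_mset (h x False) (image_mset (\<lambda>i. h i (i \<in> A)) (mset xs))))"
    using Cons.prems by (subst (1 2) Cons.IH) auto
  also have "(\<Sum>A\<in>Pow (set xs). \<Phi> (add_mset (h x False) (image_mset (\<lambda>i. h i (i \<in> A)) (mset xs))))
      = (\<Sum>A\<in>Pow (set xs). \<Phi> (image_mset (\<lambda>i. h i (i \<in> A)) (mset (x # xs))))"
  proof (intro sum.cong refl)
    fix A assume "A \<in> Pow (set xs)"
    then have "x \<notin> A" using x by auto
    then show "\<Phi> (add_mset (h x False) (image_mset (\<lambda>i. h i (i \<in> A)) (mset xs)))
      = \<Phi> (image_mset (\<lambda>i. h i (i \<in> A)) (mset (x # xs)))" by simp
  qed
  also have "(\<Sum>A\<in>Pow (set xs). \<Phi> (add_mset (h x True) (image_mset (\<lambda>i. h i (i \<in> A)) (mset xs))))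
      = (\<Sum>A\<in>insert x ` Pow (set xs). \<Phi> (image_mset (\<lambda>i. h i (i \<in> A)) (mset (x # xs))))"
  proof (subst sum.reindex)
    show "inj_on (insert x) (Pow (set xs))" using x by (intro inj_onI) (auto simp: insert_ident)
    show "(\<Sum>A\<in>Pow (set xs). \<Phi> (add_mset (h x True) (image_mset (\<lambda>i. h i (i \<in> A)) (mset xs))))
      = sum ((\<lambda>A. \<Phi> (image_mset (\<lambda>i. h i (i \<in> A)) (mset (x # xs)))) \<circ> insert x) (Pow (set xs))"
      by (simp only: comp_def mset.simps image_mset_add_mset img insertI1)
  qed
  also have "\<dots> + (\<Sum>A\<in>Pow (set xs). \<Phi> (image_mset (\<lambda>i. h i (i \<in> A)) (mset (x # xs))))
      = (\<Sum>A\<in>Pow (set (x # xs)). \<Phi> (image_mset (\<lambda>i. h i (i \<in> A)) (mset (x # xs))))"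
    unfolding list.set(2) Pow_insert using x
    by (subst sum.union_disjoint) (auto simp: add.commute)
  finally show ?case .
qed simp

section \<open>The product of two copies of the generating polynomial\<close>

definition side :: "bool \<Rightarrow> ('b \<times> bool) multiset \<Rightarrow> 'b multiset" where
  "side b \<gamma> = image_mset fst (filter_mset (\<lambda>x. snd x = b) \<gamma>)"

lemma side_simps [simp]:
  "side b {#} = {#}"
  "side b (add_mset (a, b') \<gamma>) = (if b = b' then add_mset a (side b \<gamma>) else side b \<gamma>)"
  "side b (\<gamma> + \<delta>) = side b \<gamma> + side b \<delta>"
  by (auto simp: side_def)

lemma side_replicate [simp]:
  "side b (replicate_mset k (a, b')) = (if b = b' then replicate_mset k a else {#})"
  by (induction k; cases b; cases b') simp_all

lemma size_side: "size (side True \<gamma>) + size (side False \<gamma>) = size \<gamma>"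
proof (induction \<gamma>)
  case (add x \<gamma>)
  then show ?case by (cases x) auto
qed simp

lemma hyperbolic_scale:
  assumes "hyperbolic B" "0 \<le> (k::real)"
  shows "hyperbolic (\<lambda>u w. k * B (f u) (f w))"
  unfolding hyperbolic_def
proof (intro allI impI)
  fix u w assume "0 \<le> k * B (f w) (f w)"
  then have "k * k * (B (f u) (f u) * B (f w) (f w)) \<le> k * k * (B (f u) (f w))\<^sup>2"
    using assms by (cases "k = 0") (auto simp: hyperbolic_def zero_le_mult_iff intro!: mult_left_mono)
  then show "k * B (f u) (f u) * (k * B (f w) (f w)) \<le> (k * B (f u) (f w))\<^sup>2"
    by (simp add: mult_ac power2_eq_square)
qed

text \<open>The polar form of a product of two linear forms; the defect is the square of
  \<open>l u * m w - m u * l w\<close>.\<close>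

lemma hyperbolic_product: "hyperbolic (\<lambda>u w. l u * m w + m u * (l w :: real))"
  unfolding hyperbolic_def
proof (intro allI impI)
  fix u w
  have "0 \<le> (l u * m w - m u * l w)\<^sup>2" by simp
  then show "(l u * m u + m u * l u) * (l w * m w + m w * l w) \<le> (l u * m w + m u * l w)\<^sup>2"
    by (simp add: power2_eq_square algebra_simps)
qed

context matroid
begin

text \<open>The derivatives of a product of two copies of \<open>f\<close> in disjoint sets of variables.\<close>

definition pair_coeff :: "('a option \<times> bool) multiset \<Rightarrow> real" where
  "pair_coeff \<gamma> = deriv_coeff (side True \<gamma>) * deriv_coeff (side False \<gamma>)"

text \<open>By the product rule the form has three parts: two in which one factor is reduced to a
  constant and the other to a quadratic, and one in which both factors are linear. Counting degrees
  leaves at most one of the three, so hyperbolic forms never have to be added.\<close>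

lemma pair_coeff_hyperbolic:
  assumes size: "size \<gamma> + 2 = 2 * card E"
  shows "hyperbolic (\<lambda>u w. mix (atoms \<times> UNIV) (\<lambda>\<beta>. pair_coeff (\<gamma> + \<beta>)) [u, w])"
proof -
  define k where "k b = deriv_coeff (side b \<gamma>)" for b
  define l where "l b u = (\<Sum>a\<in>atoms. u (a, b) * deriv_coeff (add_mset a (side b \<gamma>)))"
    for b and u :: "'a option \<times> bool \<Rightarrow> real"
  define Q where "Q b u w = mix atoms (\<lambda>\<beta>. deriv_coeff (side b \<gamma> + \<beta>)) [u, w]" for b u w
  define r where "r b u = (\<lambda>a. u (a, b))" for b and u :: "'a option \<times> bool \<Rightarrow> real"
  have sum2: "(\<Sum>x\<in>atoms \<times> UNIV. g x) = (\<Sum>a\<in>atoms. g (a, True)) + (\<Sum>a\<in>atoms. g (a, False))"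
    for g :: "'a option \<times> bool \<Rightarrow> real"
  proof -
    have "(\<Sum>x\<in>atoms \<times> UNIV. g x) = (\<Sum>a\<in>atoms. \<Sum>b\<in>UNIV. g (a, b))"
      by (simp add: sum.cartesian_product)
    then show ?thesis by (simp add: UNIV_bool sum.distrib add.commute)
  qed
  have eq: "mix (atoms \<times> UNIV) (\<lambda>\<beta>. pair_coeff (\<gamma> + \<beta>)) [u, w]
      = k False * Q True (r True u) (r True w) + (l True u * l False w + l False u * l True w)
        + k True * Q False (r False u) (r False w)" for u w
    unfolding mix.simps sum2 l_def sum_product Q_def r_def k_def
    by (simp add: pair_coeff_def sum_distrib_left distrib_left sum.distrib mult_ac)
  have sz: "size (side True \<gamma>) + size (side False \<gamma>) + 2 = 2 * card E" using size size_side by metis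
  have k0: "k b = 0" if "size (side b \<gamma>) \<noteq> card E" for b using that by (simp add: k_def deriv_coeff_def)
  have l0: "l b u = 0" if "size (side b \<gamma>) + 1 \<noteq> card E" for b u
    using that by (simp add: l_def deriv_coeff_def)
  have Q0: "Q b u w = 0" if "size (side b \<gamma>) + 2 \<noteq> card E" for b u w
    using that by (simp add: Q_def deriv_coeff_def)
  have Qhyp: "hyperbolic (\<lambda>u w. k c * Q b (r b u) (r b w))" if "size (side b \<gamma>) + 2 = card E" for b c
    using hyperbolic_scale[OF deriv_coeff_hyperbolic[OF that], of "k c" "r b"]
    by (simp add: Q_def k_def deriv_coeff_nonneg)
  consider "size (side True \<gamma>) + 2 = card E" | "size (side False \<gamma>) + 2 = card E"
    | "size (side True \<gamma>) + 2 \<noteq> card E" "size (side False \<gamma>) + 2 \<noteq> card E" by blast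
  then show ?thesis
  proof cases
    case 1
    with sz have "size (side False \<gamma>) + 1 \<noteq> card E" "size (side False \<gamma>) + 2 \<noteq> card E" by auto
    then show ?thesis unfolding eq using Qhyp[OF 1] by (simp add: l0 Q0)
  next
    case 2
    with sz have "size (side True \<gamma>) + 1 \<noteq> card E" "size (side True \<gamma>) + 2 \<noteq> card E" by auto
    then show ?thesis unfolding eq using Qhyp[OF 2] by (simp add: l0 Q0)
  next
    case 3
    then show ?thesis unfolding eq by (simp add: Q0 hyperbolic_product)
  qed
qed

text \<open>Each side can be filled up with derivatives along its own homogenising variable, which
  put no condition on independence.\<close>

lemma extendible_pair_iff:
  assumes "size \<gamma> + k = 2 * card E"
  shows "extendible (atoms \<times> UNIV) pair_coeff k \<gamma> \<longleftrightarrow> (\<forall>b. admissible (side b \<gamma>))"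
proof
  assume "extendible (atoms \<times> UNIV) pair_coeff k \<gamma>"
  then obtain \<beta> where "0 < pair_coeff (\<gamma> + \<beta>)" by (auto simp: extendible_def)
  then have "0 < deriv_coeff (side b (\<gamma> + \<beta>))" for b
    using deriv_coeff_nonneg[of "side True (\<gamma> + \<beta>)"] deriv_coeff_nonneg[of "side False (\<gamma> + \<beta>)"]
    by (cases b) (auto simp: pair_coeff_def zero_less_mult_iff)
  then show "\<forall>b. admissible (side b \<gamma>)"
    using admissible_subset[of "side b (\<gamma> + \<beta>)" "side b \<gamma>" for b] by (simp add: deriv_coeff_pos_iff)
next
  assume adm: "\<forall>b. admissible (side b \<gamma>)"
  define m where "m b = card E - size (side b \<gamma>)" for b
  have le: "size (side b \<gamma>) + m b = card E" for b using adm by (auto simp: admissible_def m_def)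
  define \<beta> :: "('a option \<times> bool) multiset" where "\<beta> = replicate_mset (m True) (None, True) + replicate_mset (m False) (None, False)"
  have side: "side b (\<gamma> + \<beta>) = side b \<gamma> + replicate_mset (m b) None" for b
    by (cases b) (simp_all add: \<beta>_def)
  have "0 < deriv_coeff (side b (\<gamma> + \<beta>))" for b
    unfolding side deriv_coeff_pos_iff using adm le[of b] by (simp add: admissible_replicate_None)
  then have "0 < pair_coeff (\<gamma> + \<beta>)" by (simp add: pair_coeff_def)
  moreover have "set_mset \<beta> \<subseteq> atoms \<times> UNIV" by (auto simp: \<beta>_def atoms_def split: if_splits)
  moreover have "size \<beta> = k" using assms le[of True] le[of False] size_side[of \<gamma>] by (simp add: \<beta>_def)
  ultimately show "extendible (atoms \<times> UNIV) pair_coeff k \<gamma>" unfolding extendible_def by blast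
qed

text \<open>The common neighbour is the homogenising variable of a side that has room left after
  \<open>i\<close> and also after \<open>j\<close>.\<close>

lemma pair_coeff_connected:
  assumes size: "size \<gamma> + k + 3 = 2 * card E"
    and i: "extendible (atoms \<times> UNIV) pair_coeff (k + 2) (add_mset i \<gamma>)"
    and j: "extendible (atoms \<times> UNIV) pair_coeff (k + 2) (add_mset j \<gamma>)"
  shows "\<exists>c\<in>atoms \<times> UNIV. extendible (atoms \<times> UNIV) pair_coeff (k + 1) (add_mset i (add_mset c \<gamma>)) \<and>
    extendible (atoms \<times> UNIV) pair_coeff (k + 1) (add_mset c (add_mset j \<gamma>))"
proof -
  have adm: "admissible (side b (add_mset i \<gamma>))" "admissible (side b (add_mset j \<gamma>))" for b
    using i j size by (auto simp: extendible_pair_iff)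
  then have le: "size (side b (add_mset i \<gamma>)) \<le> card E" "size (side b (add_mset j \<gamma>)) \<le> card E" for b
    by (auto simp: admissible_def)
  \<comment> \<open>A side that one more variable can fill already has size at least
    \<open>card E - 1\<close>. If both sides were of this kind, \<gamma> would have size at least
    \<open>2 * card E - 2\<close>, but it has \<open>2 * card E - 3 - k\<close>.\<close>
  have "\<exists>d. size (side d (add_mset i \<gamma>)) < card E \<and> size (side d (add_mset j \<gamma>)) < card E"
  proof (rule ccontr)
    assume *: "\<not> ?thesis"
    obtain a b a' b' where ij: "i = (a, b)" "j = (a', b')" by (metis surj_pair)
    from * have "\<not> (size (side d (add_mset i \<gamma>)) < card E \<and> size (side d (add_mset j \<gamma>)) < card E)" for d
      by blast
    from this[of True] this[of False] show False
      using le[of True] le[of False] size size_side[of \<gamma>] unfolding ij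
      by (cases b; cases b') auto
  qed
  then obtain d where d: "size (side d (add_mset i \<gamma>)) < card E" "size (side d (add_mset j \<gamma>)) < card E"
    by blast
  have "admissible (side b (add_mset (None, d) (add_mset x \<gamma>)))" if "x \<in> {i, j}" for b x
    using that adm[of b] d by (auto simp: admissible_add_None)
  then have "extendible (atoms \<times> UNIV) pair_coeff (k + 1) (add_mset (None, d) (add_mset x \<gamma>))" if "x \<in> {i, j}" for x
    using that size by (subst extendible_pair_iff) auto
  then show ?thesis
    by (intro bexI[of _ "(None, d)"]) (auto simp: atoms_def add_mset_commute)
qed

section \<open>Log-concavity of the numbers of complementary pairs\<close>

definition splits :: "nat \<Rightarrow> 'a set set" where
  "splits k = {A. A \<subseteq> E \<and> card A = k \<and> A \<in> \<I> \<and> E - A \<in> \<I>}"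

lemma finite_splits: "finite (splits k)"
  by (rule finite_subset[of _ "Pow E"]) (auto simp: splits_def finite_ground)

lemma selected_replicate: "finite A \<Longrightarrow> selected (replicate_mset p None + image_mset Some (mset_set A)) = A"
  by (auto simp: selected_def split: if_splits)

lemma admissible_replicate:
  "finite A \<Longrightarrow> admissible (replicate_mset p None + image_mset Some (mset_set A))
    \<longleftrightarrow> p + card A \<le> card E \<and> A \<in> \<I>"
proof (induction A rule: finite_induct)
  case empty
  have "selected (replicate_mset p None) = {}" using selected_replicate[of "{}"] by simp
  then show ?case by (simp add: admissible_def empty_indep)
next
  case (insert x A)
  have "A \<in> \<I>" if "insert x A \<in> \<I>" using that by (rule hereditary) auto
  then show ?case using insert by (auto simp: admissible_add_Some selected_replicate)
qed

lemma deriv_coeff_replicate: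
  "finite A \<Longrightarrow> deriv_coeff (replicate_mset p None + image_mset Some (mset_set A))
    = (if p + card A = card E \<and> A \<in> \<I> then fact p else 0)"
  by (simp add: deriv_coeff_def admissible_replicate count_eq_zero_iff[THEN iffD2] image_iff)

text \<open>The first copy receives \<open>A\<close> and \<open>p\<close> derivatives along y, so
  full degree forces \<open>card A = card E - p = q\<close>; the second copy receives the
  complement. The factorials come from differentiating y^p and z^q.\<close>

lemma sum_pair_coeff:
  assumes "p + q = card E"
  shows "(\<Sum>A\<in>Pow E. pair_coeff (replicate_mset p (None, True) + (replicate_mset q (None, False)
      + image_mset (\<lambda>i. (Some i, i \<in> A)) (mset_set E)))) = fact p * fact q * card (splits q)"
proof -
  have "pair_coeff (replicate_mset p (None, True) + (replicate_mset q (None, False)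
      + image_mset (\<lambda>i. (Some i, i \<in> A)) (mset_set E))) = (if A \<in> splits q then fact p * fact q else 0)"
    if A: "A \<in> Pow E" for A
  proof -
    have side: "side b (image_mset (\<lambda>i. (Some i, i \<in> A)) (mset_set E))
      = image_mset Some (mset_set (if b then A else E - A))" for b
    proof -
      have "{i \<in> E. (i \<in> A) = b} = (if b then A else E - A)" using A by auto
      then show ?thesis
        using finite_ground by (simp add: side_def filter_mset_image_mset multiset.map_comp comp_def)
    qed
    have fin: "finite A" "A \<subseteq> E" using A finite_ground finite_subset by auto
    then have cards: "card (E - A) = card E - card A" "card A \<le> card E"
      using finite_ground by (auto simp: card_Diff_subset card_mono)
    have "pair_coeff (replicate_mset p (None, True) + (replicate_mset q (None, False)
      + image_mset (\<lambda>i. (Some i, i \<in> A)) (mset_set E)))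
      = deriv_coeff (replicate_mset p None + image_mset Some (mset_set A))
        * deriv_coeff (replicate_mset q None + image_mset Some (mset_set (E - A)))"
      by (simp add: pair_coeff_def side)
    also have "\<dots> = (if A \<in> splits q then fact p * fact q else 0)"
      using fin cards assms finite_ground by (auto simp: deriv_coeff_replicate splits_def)
    finally show ?thesis .
  qed
  then have "(\<Sum>A\<in>Pow E. pair_coeff (replicate_mset p (None, True) + (replicate_mset q (None, False)
      + image_mset (\<lambda>i. (Some i, i \<in> A)) (mset_set E)))) = (\<Sum>A\<in>Pow E. if A \<in> splits q then fact p * fact q else 0)"
    by (intro sum.cong refl)
  also have "\<dots> = (\<Sum>A\<in>splits q. fact p * fact q)"
    by (rule sum.mono_neutral_cong_right) (auto simp: finite_ground splits_def)
  finally show ?thesis by simp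
qed

text \<open>\<open>mix_hyperbolic\<close> at the coordinate directions of y and z. The fixed
  directions are \<open>p\<close> times y, \<open>q\<close> times z and one e_i + e_i' for each
  element, together \<open>2 * card E - 2\<close>.\<close>

lemma splits_log_concave:
  assumes n: "p + q + 2 = card E"
  defines "s \<equiv> \<lambda>p q. fact p * fact q * real (card (splits q))"
  shows "s (p + 2) q * s p (q + 2) \<le> (s (p + 1) (q + 1))\<^sup>2"
proof -
  let ?X = "atoms \<times> (UNIV :: bool set)"
  obtain xs where xs: "set xs = E" "distinct xs" using finite_ground finite_distinct_list by blast
  define vs where "vs = replicate p (unit_vec (None, True)) @ replicate q (unit_vec (None, False))
    @ map (\<lambda>i x. unit_vec (Some i, True) x + unit_vec (Some i, False) x) xs"
  have fin: "finite ?X" by (simp add: finite_atoms)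
  have atom: "(None, b) \<in> ?X" for b by (simp add: atoms_def)
  have "length xs = card E" using xs distinct_card by metis
  then have len: "length vs + 2 = 2 * card E" using n by (simp add: vs_def)
  have mset_xs: "mset xs = mset_set E" using xs mset_set_set by metis
  have val: "mix ?X pair_coeff (unit_vec (None, b) # unit_vec (None, b') # vs)
    = (\<Sum>A\<in>Pow E. pair_coeff (add_mset (None, b) (add_mset (None, b') (replicate_mset p (None, True)
      + (replicate_mset q (None, False) + image_mset (\<lambda>i. (Some i, i \<in> A)) (mset_set E))))))" for b b'
    unfolding vs_def mix_unit_vec[OF fin atom] mix_replicate[OF fin atom]
    by (subst mix_choices[OF fin xs(2), where h = "\<lambda>i b. (Some i, b)"]) (use xs mset_xs in \<open>auto simp: atoms_def\<close>)
  have TT: "mix ?X pair_coeff (unit_vec (None, True) # unit_vec (None, True) # vs) = s (p + 2) q"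
    using sum_pair_coeff[of "p + 2" q] n by (simp add: val s_def del: fact_Suc mix.simps)
  have FF: "mix ?X pair_coeff (unit_vec (None, False) # unit_vec (None, False) # vs) = s p (q + 2)"
    using sum_pair_coeff[of p "q + 2"] n by (simp add: val s_def del: fact_Suc mix.simps)
  have TF: "mix ?X pair_coeff (unit_vec (None, True) # unit_vec (None, False) # vs) = s (p + 1) (q + 1)"
    using sum_pair_coeff[of "p + 1" "q + 1"] n by (simp add: val s_def add_mset_commute del: fact_Suc mix.simps)
  show ?thesis
    unfolding TT[symmetric] FF[symmetric] TF[symmetric]
  proof (rule mix_hyperbolic[OF fin])
    show "0 \<le> pair_coeff \<alpha>" for \<alpha> by (simp add: pair_coeff_def deriv_coeff_nonneg)
    show "hyperbolic (\<lambda>u w. mix ?X (\<lambda>\<beta>. pair_coeff (\<alpha> + \<beta>)) [u, w])" if "size \<alpha> = length vs" for \<alpha>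
      using that len by (intro pair_coeff_hyperbolic) simp
    show "\<exists>c\<in>?X. extendible ?X pair_coeff (k + 1) (add_mset i (add_mset c \<alpha>)) \<and>
        extendible ?X pair_coeff (k + 1) (add_mset c (add_mset j \<alpha>))"
      if "size \<alpha> + k + 1 = length vs" "extendible ?X pair_coeff (k + 2) (add_mset i \<alpha>)"
        "extendible ?X pair_coeff (k + 2) (add_mset j \<alpha>)" for \<alpha> i j k
      using that len by (intro pair_coeff_connected) auto
    show "0 \<le> v i" if "v \<in> set vs" for v i using that by (auto simp: vs_def)
  qed simp
qed

lemma card_splits_sym: "k \<le> card E \<Longrightarrow> card (splits (card E - k)) = card (splits k)"
proof (rule bij_betw_same_card[of "\<lambda>A. E - A"])
  assume "k \<le> card E"
  then show "bij_betw (\<lambda>A. E - A) (splits (card E - k)) (splits k)"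
    by (intro bij_betwI[of _ _ _ "\<lambda>A. E - A"])
      (auto simp: splits_def double_diff card_Diff_subset indep_finite)
qed

text \<open>The size bound makes the part with \<open>k + 1\<close> elements the larger one, and
  augmentation moves one of its elements to the other part.\<close>

lemma splits_descend:
  assumes "splits (k + 1) \<noteq> {}" "card E \<le> 2 * k + 1"
  shows "splits k \<noteq> {}"
proof -
  obtain A where A: "A \<subseteq> E" "card A = k + 1" "A \<in> \<I>" "E - A \<in> \<I>"
    using assms(1) by (auto simp: splits_def)
  have "card (E - A) < card A" using A assms(2) by (simp add: card_Diff_subset indep_finite)
  from augmentation[OF A(4,3) this] obtain e where e: "e \<in> A" "insert e (E - A) \<in> \<I>" by blast
  have "E - (A - {e}) = insert e (E - A)" using A e by auto
  moreover have "A - {e} \<in> \<I>" using A(3) by (rule hereditary) auto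
  ultimately have "A - {e} \<in> splits k" using A e by (auto simp: splits_def indep_finite)
  then show ?thesis by blast
qed

lemma card_splits_step:
  assumes n: "card E \<le> 2 * k"
  shows "(k + 1) * card (splits (k + 1)) \<le> (card E - k) * card (splits k)"
proof (cases "k < card E")
  case False
  have "A \<notin> splits (k + 1)" for A
    using card_mono[OF finite_ground, of A] False by (auto simp: splits_def)
  then have "splits (k + 1) = {}" by blast
  then show ?thesis by simp
next
  case True
  define c where "c j = fact (card E - j) * fact j * real (card (splits j))" for j
  have cpos: "0 < c j \<longleftrightarrow> splits j \<noteq> {}" for j
    using finite_splits[of j] by (simp add: c_def card_gt_0_iff zero_less_mult_iff)
  have "c (k + 1) \<le> c k"
  proof (rule symmetric_log_concave_le[OF _ _ _ _ n True])
    show "c (j - 1) * c (j + 1) \<le> (c j)\<^sup>2" if "0 < j" "j < card E" for j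
    proof -
      define p q where "p = card E - j - 1" and "q = j - 1"
      have pq: "p + q + 2 = card E" "j = q + 1" using that by (auto simp: p_def q_def)
      then have "card E - (j - 1) = p + 2" "card E - j = p + 1" "card E - (j + 1) = p" "j - 1 = q" "j + 1 = q + 2"
        by auto
      then show ?thesis using splits_log_concave[OF pq(1)] pq(2) by (simp add: c_def)
    qed
    show "c (card E - j) = c j" if "j \<le> card E" for j
      using that by (simp add: c_def card_splits_sym)
    show "0 < c j" if "0 < c (k + 1)" "card E - (k + 1) \<le> j" "j \<le> k + 1" for j
    proof -
      \<comment> \<open>Positions from \<open>k + 1\<close> down to the middle are reached by moving
        elements across; those below the middle follow by complementation.\<close>
      have top: "splits i \<noteq> {}" if "card E \<le> 2 * i + 1" "i \<le> k + 1" for i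
        using that(2,1)
      proof (induction rule: inc_induct)
        case base
        then show ?case using \<open>0 < c (k + 1)\<close> cpos by simp
      next
        case (step i)
        then show ?case using splits_descend[of i] by simp
      qed
      show ?thesis
      proof (cases "card E \<le> 2 * j + 1")
        case True
        then show ?thesis using top that(3) cpos by simp
      next
        case False
        then have "splits (card E - j) \<noteq> {}" using that by (intro top) auto
        moreover have "card (splits (card E - j)) = card (splits j)"
          using False by (intro card_splits_sym) auto
        ultimately show ?thesis using finite_splits cpos by (metis card_0_eq)
      qed
    qed
    show "0 \<le> c k" by (simp add: c_def)
  qed
  moreover have "c (k + 1) = fact (card E - (k + 1)) * fact k * real ((k + 1) * card (splits (k + 1)))"
    by (simp add: c_def algebra_simps)
  moreover have "c k = fact (card E - (k + 1)) * fact k * real ((card E - k) * card (splits k))"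
  proof -
    have "card E - k = Suc (card E - (k + 1))" using True by simp
    then have "fact (card E - k) = real (card E - k) * fact (card E - (k + 1))" by (metis fact_Suc of_nat_id)
    then show ?thesis by (simp add: c_def)
  qed
  ultimately have "fact (card E - (k + 1)) * fact k * real ((k + 1) * card (splits (k + 1)))
     \<le> fact (card E - (k + 1)) * fact k * real ((card E - k) * card (splits k))" by simp
  moreover have "(0::real) < fact (card E - (k + 1)) * fact k" by simp
  ultimately have "real ((k + 1) * card (splits (k + 1))) \<le> real ((card E - k) * card (splits k))"
    by (simp only: mult_le_cancel_left_pos)
  then show ?thesis by (simp only: of_nat_le_iff)
qed

end

section \<open>Coefficientwise inequalities\<close>

lemma (in matroid) contraction_matroid:
  assumes "S \<in> \<I>" "T \<subseteq> E - S"
  shows "matroid T {A. A \<subseteq> T \<and> S \<union> A \<in> \<I>}"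
proof
  show "finite T" using assms(2) finite_ground finite_subset by blast
  show "{} \<in> {A. A \<subseteq> T \<and> S \<union> A \<in> \<I>}" using assms(1) by simp
  show "I \<subseteq> T" if "I \<in> {A. A \<subseteq> T \<and> S \<union> A \<in> \<I>}" for I using that by simp
  show "J \<in> {A. A \<subseteq> T \<and> S \<union> A \<in> \<I>}" if "I \<in> {A. A \<subseteq> T \<and> S \<union> A \<in> \<I>}" "J \<subseteq> I" for I J
  proof -
    have "S \<union> J \<in> \<I>" using hereditary[of "S \<union> I" "S \<union> J"] that by blast
    then show ?thesis using that by auto
  qed
  show "\<exists>e\<in>J - I. insert e I \<in> {A. A \<subseteq> T \<and> S \<union> A \<in> \<I>}"
    if I: "I \<in> {A. A \<subseteq> T \<and> S \<union> A \<in> \<I>}" and J: "J \<in> {A. A \<subseteq> T \<and> S \<union> A \<in> \<I>}"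
      and less: "card I < card J" for I J
  proof -
    have "finite S" "finite I" "finite J"
      using assms(1) I J indep_finite by (auto dest!: indep_finite)
    moreover have "S \<inter> I = {}" "S \<inter> J = {}" using I J assms(2) by auto
    ultimately have "card (S \<union> I) < card (S \<union> J)" using less by (simp add: card_Un_disjoint)
    with augmentation[of "S \<union> I" "S \<union> J"] I J
    obtain e where "e \<in> (S \<union> J) - (S \<union> I)" "insert e (S \<union> I) \<in> \<I>" by auto
    then show ?thesis using I J by (intro bexI[of _ e]) auto
  qed
qed

section \<open>Coefficients of products as numbers of pairs\<close>

definition monom_of :: "'a set \<Rightarrow> 'a \<Rightarrow>\<^sub>0 nat" where
  "monom_of A = (\<Sum>i\<in>A. Poly_Mapping.single i 1)"

lemma lookup_monom_of: "finite A \<Longrightarrow> Poly_Mapping.lookup (monom_of A) i = of_bool (i \<in> A)"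
  by (simp add: monom_of_def lookup_sum lookup_single when_def)

lemma prod_Var: "finite A \<Longrightarrow> (\<Prod>i\<in>A. Var i) = Poly_Mapping.single (monom_of A) 1"
  by (induction A rule: finite_induct) (simp_all add: Var_def monom_of_def mult_single)

definition (in matroid) cover_pairs :: "('a \<Rightarrow>\<^sub>0 nat) \<Rightarrow> nat \<Rightarrow> nat \<Rightarrow> ('a set \<times> 'a set) set" where
  "cover_pairs m a b = {(A, B). A \<in> \<I> \<and> B \<in> \<I> \<and> card A = a \<and> card B = b \<and> monom_of A + monom_of B = m}"

context matroid
begin

lemma finite_indep: "finite \<I>"
  by (rule finite_subset[of _ "Pow E"]) (use indep_subset_ground finite_ground in auto)

lemma lookup_indep_poly_mult:
  "Poly_Mapping.lookup (indep_poly \<I> a * indep_poly \<I> b) m = card (cover_pairs m a b)"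
proof -
  let ?P = "\<lambda>k. {I. I \<in> \<I> \<and> card I = k}"
  have fin: "finite (?P k)" for k using finite_indep by simp
  have poly: "indep_poly \<I> k = (\<Sum>I\<in>?P k. Poly_Mapping.single (monom_of I) 1)" for k
    unfolding indep_poly_def by (intro sum.cong refl) (auto simp: prod_Var indep_finite)
  have "Poly_Mapping.lookup (indep_poly \<I> a * indep_poly \<I> b) m
      = (\<Sum>A\<in>?P a. \<Sum>B\<in>?P b. if monom_of A + monom_of B = m then 1 else 0)"
    unfolding poly sum_product by (simp add: lookup_sum mult_single lookup_single when_def)
  also have "\<dots> = (\<Sum>x\<in>?P a \<times> ?P b. if monom_of (fst x) + monom_of (snd x) = m then 1 else 0)"
    by (simp add: sum.cartesian_product case_prod_beta)
  also have "\<dots> = card {x \<in> ?P a \<times> ?P b. monom_of (fst x) + monom_of (snd x) = m}"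
    using fin by (simp flip: sum.inter_filter)
  also have "{x \<in> ?P a \<times> ?P b. monom_of (fst x) + monom_of (snd x) = m} = cover_pairs m a b"
    by (auto simp: cover_pairs_def)
  finally show ?thesis .
qed

text \<open>Exponent 2 marks \<open>S\<close> and exponent 1 marks \<open>T\<close>, so every pair
  with this monomial has intersection \<open>S\<close> and is determined by how it divides
  \<open>T\<close>. The sizes \<open>a\<close> and \<open>b\<close> may differ from those of
  \<open>A\<close> and \<open>B\<close>, so that a single pair describes two different
  coefficients.\<close>

lemma card_cover_pairs_eq:
  assumes A: "A \<in> \<I>" and B: "B \<in> \<I>"
    and a: "card (A \<inter> B) \<le> a" and ab: "a + b = card A + card B"
  defines "S \<equiv> A \<inter> B" and "T \<equiv> (A - B) \<union> (B - A)"
  shows "card (cover_pairs (monom_of A + monom_of B) a b)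
    = card (matroid.splits T {X. X \<subseteq> T \<and> S \<union> X \<in> \<I>} (a - card S))"
proof -
  have SI: "S \<in> \<I>" using A hereditary by (auto simp: S_def)
  have TE: "T \<subseteq> E - S" using A B indep_subset_ground by (auto simp: S_def T_def)
  interpret C: matroid T "{X. X \<subseteq> T \<and> S \<union> X \<in> \<I>}" by (rule contraction_matroid[OF SI TE])
  have fin: "finite A" "finite B" "finite S" "finite T" using A B SI indep_finite C.finite_ground by auto
  have "A = S \<union> (A - B)" "B = S \<union> (B - A)" by (auto simp: S_def)
  then have "card A = card S + card (A - B)" "card B = card S + card (B - A)"
    using fin card_Un_disjoint[of S "A - B"] card_Un_disjoint[of S "B - A"] by (auto simp: S_def)
  moreover have "card T = card (A - B) + card (B - A)"
    unfolding T_def using fin by (intro card_Un_disjoint) auto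
  ultimately have sz: "a + b = 2 * card S + card T" using ab by simp
  define h where "h X = (S \<union> X, S \<union> (T - X))" for X
  have cards: "card (S \<union> X) = card S + card X" "card (S \<union> (T - X)) + card X = card S + card T"
    if "X \<subseteq> T" for X
  proof -
    have X: "finite X" "S \<inter> X = {}" "S \<inter> (T - X) = {}" using that fin(4) TE finite_subset by auto
    show "card (S \<union> X) = card S + card X" using X fin by (simp add: card_Un_disjoint)
    have "card X \<le> card T" using that fin by (simp add: card_mono)
    then show "card (S \<union> (T - X)) + card X = card S + card T"
      using X fin that by (simp add: card_Un_disjoint card_Diff_subset)
  qed
  have "bij_betw h (C.splits (a - card S)) (cover_pairs (monom_of A + monom_of B) a b)"
    unfolding bij_betw_def
  proof
    have "X = T \<inter> fst (h X)" if "X \<subseteq> T" for X using that TE by (auto simp: h_def)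
    then show "inj_on h (C.splits (a - card S))"
      by (intro inj_on_inverseI[where g = "\<lambda>y. T \<inter> fst y"]) (simp add: C.splits_def)
    show "h ` C.splits (a - card S) = cover_pairs (monom_of A + monom_of B) a b"
    proof (intro equalityI subsetI)
      fix y assume "y \<in> h ` C.splits (a - card S)"
      then obtain X where X: "X \<subseteq> T" "card X = a - card S" "S \<union> X \<in> \<I>" "S \<union> (T - X) \<in> \<I>" "y = h X"
        by (auto simp: C.splits_def)
      have "card (S \<union> X) = a" "card (S \<union> (T - X)) = b"
        using cards[OF X(1)] X(2) a sz by (auto simp: S_def)
      moreover have "monom_of (S \<union> X) + monom_of (S \<union> (T - X)) = monom_of A + monom_of B"
      proof (rule poly_mapping_eqI)
        fix i
        have "finite X" using X(1) fin(4) finite_subset by blast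
        then show "Poly_Mapping.lookup (monom_of (S \<union> X) + monom_of (S \<union> (T - X))) i
          = Poly_Mapping.lookup (monom_of A + monom_of B) i"
          using fin X(1) by (auto simp: lookup_add lookup_monom_of S_def T_def)
      qed
      ultimately show "y \<in> cover_pairs (monom_of A + monom_of B) a b"
        using X by (simp add: cover_pairs_def h_def)
    next
      fix y assume "y \<in> cover_pairs (monom_of A + monom_of B) a b"
      then obtain A' B' where y: "y = (A', B')" "A' \<in> \<I>" "B' \<in> \<I>" "card A' = a" "card B' = b"
        "monom_of A' + monom_of B' = monom_of A + monom_of B" by (auto simp: cover_pairs_def)
      have fin': "finite A'" "finite B'" using y indep_finite by auto
      have eq: "of_bool (i \<in> A') + of_bool (i \<in> B') = (of_bool (i \<in> A) + of_bool (i \<in> B) :: nat)" for i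
        using arg_cong[OF y(6), of "\<lambda>f. Poly_Mapping.lookup f i"] fin fin'
        by (simp add: lookup_add lookup_monom_of)
      have mem: "i \<in> A' \<inter> B' \<longleftrightarrow> i \<in> S" "i \<in> (A' - B') \<union> (B' - A') \<longleftrightarrow> i \<in> T" for i
        using eq[of i] by (auto simp: S_def T_def of_bool_def split: if_splits)
      have ST: "A' = S \<union> (A' - B')" "B' = S \<union> (T - (A' - B'))" "A' - B' \<subseteq> T"
        using mem by blast+
      have "card (A' - B') = a - card S" using cards(1)[OF ST(3)] ST(1) y(4) by simp
      then have "A' - B' \<in> C.splits (a - card S)" using ST y by (auto simp: C.splits_def)
      moreover have "y = h (A' - B')" using ST y(1) by (simp add: h_def)
      ultimately show "y \<in> h ` C.splits (a - card S)" by blast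
    qed
  qed
  from bij_betw_same_card[OF this] show ?thesis by simp
qed

text \<open>A pair counted on the left fixes \<open>S\<close> and \<open>T\<close> for both sides,
  which become neighbouring split counts in the contraction. This yields the factor
  \<open>(a + 1 - s) / (b - s)\<close> with \<open>s = card S\<close>.\<close>

lemma card_cover_pairs_step:
  assumes "b \<le> a" "0 < b"
  shows "(a + 1) * card (cover_pairs m (a + 1) (b - 1)) \<le> b * card (cover_pairs m a b)"
proof (cases "cover_pairs m (a + 1) (b - 1) = {}")
  case False
  then obtain A B where AB: "A \<in> \<I>" "B \<in> \<I>" "card A = a + 1" "card B = b - 1" "m = monom_of A + monom_of B"
    by (auto simp: cover_pairs_def)
  define S where "S = A \<inter> B"
  define T where "T = (A - B) \<union> (B - A)"
  have SI: "S \<in> \<I>" using AB hereditary by (auto simp: S_def)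
  have TE: "T \<subseteq> E - S" using AB indep_subset_ground by (auto simp: S_def T_def)
  interpret C: matroid T "{X. X \<subseteq> T \<and> S \<union> X \<in> \<I>}" by (rule contraction_matroid[OF SI TE])
  have fin: "finite A" "finite B" using AB indep_finite by auto
  have s: "card S \<le> b - 1" using card_mono[of B S] fin AB by (simp add: S_def)
  define s where "s = card S"
  have sb: "s < b" using s assms by (simp add: s_def)
  have "card A = s + card (A - B)" "card B = s + card (B - A)"
    unfolding s_def S_def using fin by (metis card_Int_Diff) (metis card_Int_Diff fin(2) Int_commute)
  moreover have "card T = card (A - B) + card (B - A)"
    unfolding T_def using fin by (intro card_Un_disjoint) auto
  ultimately have T: "card T + 2 * s = a + b" using AB assms by simp
  have N1: "card (cover_pairs m (a + 1) (b - 1)) = card (C.splits (a + 1 - s))"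
    unfolding AB(5) s_def S_def T_def
    using AB s assms by (intro card_cover_pairs_eq) (auto simp: S_def)
  have N0: "card (cover_pairs m a b) = card (C.splits (a - s))"
    unfolding AB(5) s_def S_def T_def
    using AB s assms by (intro card_cover_pairs_eq) (auto simp: S_def)
  have idx: "a - s + 1 = a + 1 - s" "card T - (a - s) = b - s" using T sb assms by auto
  have "(a - s + 1) * card (C.splits (a - s + 1)) \<le> (card T - (a - s)) * card (C.splits (a - s))"
    using T assms sb by (intro C.card_splits_step) auto
  then have le: "(a + 1 - s) * card (C.splits (a + 1 - s)) \<le> (b - s) * card (C.splits (a - s))"
    unfolding idx .
  \<comment> \<open>Subtracting \<open>s\<close> from numerator and denominator does not decrease
    \<open>(a + 1) / b\<close>, because \<open>b \<le> a + 1\<close>.\<close>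
  have "(a + 1) * (b - s) \<le> b * (a + 1 - s)"
  proof -
    have "b * s \<le> (a + 1) * s" using assms by (intro mult_right_mono) auto
    then have "(a + 1) * b - (a + 1) * s \<le> (a + 1) * b - b * s" by (rule diff_le_mono2)
    then show ?thesis by (simp only: diff_mult_distrib diff_mult_distrib2 mult.commute)
  qed
  then have "(a + 1) * (b - s) * card (C.splits (a - s)) \<le> b * (a + 1 - s) * card (C.splits (a - s))"
    by (rule mult_right_mono) simp
  moreover have "(a + 1) * ((a + 1 - s) * card (C.splits (a + 1 - s)))
      \<le> (a + 1) * ((b - s) * card (C.splits (a - s)))"
    using le by (rule mult_left_mono) simp
  ultimately have "(a + 1 - s) * ((a + 1) * card (C.splits (a + 1 - s)))
      \<le> (a + 1 - s) * (b * card (C.splits (a - s)))"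
    by (simp only: mult_ac)
  then show ?thesis unfolding N0 N1 using sb assms by simp
qed simp

lemma lookup_Const_mult: "Poly_Mapping.lookup (Const r * F) m = r * Poly_Mapping.lookup F m"
  by (simp add: Const_def mult_map_scale_conv_mult[symmetric] Poly_Mapping.map.rep_eq when_def)

lemma indep_poly_exchange:
  assumes "b \<le> a" "0 < b" "r * real b \<le> real a + 1"
  shows "indep_poly \<I> a * indep_poly \<I> b \<succeq> Const r * (indep_poly \<I> (a + 1) * indep_poly \<I> (b - 1))"
  unfolding coeff_ge_def
proof
  fix m
  define x where "x = real (card (cover_pairs m (a + 1) (b - 1)))"
  define y where "y = real (card (cover_pairs m a b))"
  have "real b * (r * x) = r * real b * x" by simp
  also have "\<dots> \<le> (real a + 1) * x" using assms(3) by (intro mult_right_mono) (auto simp: x_def)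
  also have "\<dots> \<le> real b * y"
  proof -
    have "real ((a + 1) * card (cover_pairs m (a + 1) (b - 1))) \<le> real (b * card (cover_pairs m a b))"
      using card_cover_pairs_step[OF assms(1,2)] by (simp only: of_nat_le_iff)
    then show ?thesis by (simp add: x_def y_def algebra_simps)
  qed
  finally have "r * x \<le> y" using assms(2) by simp
  then show "0 \<le> Poly_Mapping.lookup (indep_poly \<I> a * indep_poly \<I> b
      - Const r * (indep_poly \<I> (a + 1) * indep_poly \<I> (b - 1))) m"
    unfolding lookup_minus lookup_Const_mult lookup_indep_poly_mult x_def y_def by simp
qed

end

section \<open>The coefficientwise order and the iteration\<close>

lemma coeff_ge_trans: "F \<succeq> G \<Longrightarrow> G \<succeq> H \<Longrightarrow> F \<succeq> H"
  unfolding coeff_ge_def lookup_minus by (meson diff_ge_0_iff_ge order_trans)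

lemma coeff_ge_refl: "F \<succeq> F"
  by (simp add: coeff_ge_def)

lemma mult_coeff_ge_0:
  assumes "F \<succeq> 0" "G \<succeq> 0" shows "F * G \<succeq> 0"
proof -
  have sum: "F = (\<Sum>k\<in>Poly_Mapping.keys F. Poly_Mapping.single k (Poly_Mapping.lookup F k))" for F :: "'a rpoly"
    by (rule poly_mapping_eqI) (simp add: lookup_sum lookup_single when_def in_keys_iff)
  have "F * G = (\<Sum>k\<in>Poly_Mapping.keys F. \<Sum>j\<in>Poly_Mapping.keys G. Poly_Mapping.single (k + j) (Poly_Mapping.lookup F k * Poly_Mapping.lookup G j))"
    by (subst sum[of F], subst sum[of G]) (simp only: sum_product mult_single)
  then show ?thesis
    using assms by (auto simp: coeff_ge_def lookup_sum lookup_single when_def intro!: sum_nonneg)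
qed

lemma coeff_ge_mult_right:
  assumes "F \<succeq> G" "H \<succeq> 0" shows "F * H \<succeq> G * H"
proof -
  have "F - G \<succeq> 0" using assms(1) by (simp add: coeff_ge_def)
  from mult_coeff_ge_0[OF this assms(2)] show ?thesis by (simp add: coeff_ge_def left_diff_distrib)
qed

lemma Const_coeff_ge_0: "0 \<le> r \<Longrightarrow> Const r \<succeq> 0"
  by (simp add: coeff_ge_def Const_def lookup_single when_def)

lemma Const_mult: "Const (r * t) = Const r * Const t"
  by (simp add: Const_def mult_single)

lemma indep_poly_coeff_ge_0:
  assumes "matroid E \<I>" shows "indep_poly \<I> k \<succeq> 0"
proof -
  interpret matroid E \<I> by fact
  show ?thesis
    unfolding coeff_ge_def indep_poly_def
    by (auto simp: prod_Var indep_finite lookup_sum lookup_single when_def intro!: sum_nonneg)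
qed

lemma power_coeff_ge_0: "F \<succeq> 0 \<Longrightarrow> F ^ k \<succeq> 0"
proof (induction k)
  case 0
  show ?case by (simp add: coeff_ge_def lookup_one when_def)
next
  case (Suc k)
  then show ?case by (simp add: mult_coeff_ge_0)
qed

theorem theorem4p1:
  fixes n p l :: nat and \<I> :: "nat set set"
  assumes "matroid {1..n} \<I>"
    and "p \<ge> 2"
    and "p - 1 < l" and "l < matroid_rank \<I>"
  shows "indep_poly \<I> l ^ p \<succeq>
    Const (\<Prod>j=1..p-1. 1 + real j / ((real p - 1) * real l)) *
      indep_poly \<I> (l + 1) ^ (p - 1) * indep_poly \<I> (l - p + 1)"
proof -
  interpret matroid "{1..n}" \<I> by fact
  define f where "f = indep_poly \<I>"
  define c where "c j = 1 + real j / ((real p - 1) * real l)" for j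
  have cpos: "0 \<le> c j" for j using assms(2) by (simp add: c_def)
  have f0: "f k \<succeq> 0" for k unfolding f_def using assms(1) by (rule indep_poly_coeff_ge_0)
  \<comment> \<open>The bound needed is \<open>c (j + 1) * (l - j) \<le> l + 1\<close>. The left
    side is \<open>l - j\<close> plus \<open>j + 1\<close> times
    \<open>(l - j) / ((p - 1) * l)\<close>, and this quotient is at most 1.\<close>
  have step: "f l * f (l - j) \<succeq> Const (c (j + 1)) * (f (l + 1) * f (l - (j + 1)))" if "j < p - 1" for j
  proof -
    have jl: "j < l" using that assms by simp
    have "(real j + 1) * real (l - j) \<le> (real j + 1) * ((real p - 1) * real l)"
    proof (rule mult_left_mono)
      have "real (l - j) \<le> 1 * real l" by simp
      also have "\<dots> \<le> (real p - 1) * real l" using assms(2) by (intro mult_right_mono) auto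
      finally show "real (l - j) \<le> (real p - 1) * real l" .
    qed simp
    moreover have "0 < (real p - 1) * real l" using assms by simp
    ultimately have "(real j + 1) / ((real p - 1) * real l) * real (l - j) \<le> real j + 1"
      by (simp add: divide_le_eq)
    moreover have "c (j + 1) * real (l - j) = real (l - j) + (real j + 1) / ((real p - 1) * real l) * real (l - j)"
      by (simp add: c_def distrib_right add.commute)
    ultimately have "c (j + 1) * real (l - j) \<le> real l + 1"
      using jl by (simp add: of_nat_diff)
    then show ?thesis
      using indep_poly_exchange[of "l - j" l "c (j + 1)"] jl by (simp add: f_def)
  qed
  \<comment> \<open>Each round multiplies by one more \<open>f l\<close>, which is exchanged with
    the trailing \<open>f (l - j)\<close>; the factors already produced only need to be
    coefficientwise nonnegative.\<close>
  have "f l ^ (j + 1) \<succeq> Const (\<Prod>i=1..j. c i) * f (l + 1) ^ j * f (l - j)" if "j \<le> p - 1" for j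
    using that
  proof (induction j)
    case 0
    have "Const 1 = (1 :: nat rpoly)" by (simp add: Const_def)
    then show ?case by (simp add: coeff_ge_refl)
  next
    case (Suc j)
    define K where "K = Const (\<Prod>i=1..j. c i) * f (l + 1) ^ j"
    have K: "K \<succeq> 0"
      unfolding K_def by (intro mult_coeff_ge_0 Const_coeff_ge_0 power_coeff_ge_0 f0 prod_nonneg) (simp add: cpos)
    have "f l ^ (j + 1) * f l \<succeq> K * f (l - j) * f l"
      using Suc f0 unfolding K_def by (intro coeff_ge_mult_right) simp
    then have "f l ^ (j + 1) * f l \<succeq> f l * f (l - j) * K" by (simp only: mult_ac)
    moreover have "f l * f (l - j) * K \<succeq> Const (c (j + 1)) * (f (l + 1) * f (l - (j + 1))) * K"
      using Suc.prems by (intro coeff_ge_mult_right step K) simp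
    ultimately have "f l ^ (j + 1) * f l \<succeq> Const (c (j + 1)) * (f (l + 1) * f (l - (j + 1))) * K"
      by (rule coeff_ge_trans)
    moreover have "Const (c (j + 1)) * (f (l + 1) * f (l - (j + 1))) * K
        = Const (\<Prod>i=1..Suc j. c i) * f (l + 1) ^ Suc j * f (l - Suc j)"
      by (simp add: K_def Const_mult mult_ac)
    ultimately show ?case by (simp only: Suc_eq_plus1 power_add power_one_right)
  qed
  \<comment> \<open>From \<open>p - 1 < l\<close> one has \<open>p \<le> l\<close>, so the truncated
    difference \<open>l - p + 1\<close> equals \<open>l - (p - 1)\<close>.\<close>
  from this[of "p - 1"] assms show ?thesis by (simp add: f_def c_def Suc_diff_le)
qed

end
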